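(* Let $M=2^m$ and let $\Omega=[\mathbb{X}_{\mathrm{PAM}},\mathbb{L}_m,\mathbb{U}_M]$ where $\mathbb{X}_{\mathrm{PAM}}$ is the $M$-PAM input alphabet, the input distribution is uniform, and $\mathbb{L}_m$ is one of the labelings $\mathbb{G}_m$ ($m\ge1$), $\mathbb{N}_m$ ($m\ge1$), $\mathbb{S}_m$ ($m\ge3$), $\mathbb{F}_m$ ($m\ge2$). Then the first-order coefficient of the BICM capacity is $$\alpha^{\mathrm{BI}}_\Omega=\begin{cases}\dfrac{3M^2}{4(M^2-1)}\log_2 e, & \text{if } \mathbb{L}_m=\mathbb{G}_m\text{ or }\mathbb{L}_m=\mathbb{F}_m,\\[1ex] \log_2 e, & \text{if }\mathbb{L}_m=\mathbb{N}_m,\\ 0, & \text{if }\mathbb{L}_m=\mathbb{S}_m.\end{cases}$$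
   Context: $M$-PAM. The $M$-PAM input alphabet $\mathbb{X}_{\mathrm{PAM}}$ is the column vector with entries $x_i=-(M-2i-1)$, $i=0,\ldots,M-1$ (dimension $N=1$). Labelings. A binary labeling of order $m$ is an $M\times m$ matrix whose rows $\boldsymbol{c}_i=[c_{i,0},\ldots,c_{i,m-1}]$, $i=0,\ldots,M-1$, are the $M$ distinct elements of $\{0,1\}^m$. The reflection of a labeling with rows $\boldsymbol{c}_0,\ldots,\boldsymbol{c}_{M-1}$ is the labeling of order $m+1$ obtained from the matrix with rows $\boldsymbol{c}_0,\ldots,\boldsymbol{c}_{M-1},\boldsymbol{c}_{M-1},\ldots,\boldsymbol{c}_0$ by adding an extra column on the left consisting of $M$ zeros followed by $M$ ones. - The binary reflected Gray code (BRGC) $\mathbb{G}_m$, $m\ge1$, is obtained from $[0,1]^{T}$ by $m-1$ recursive reflections. - The natural binary code (NBC) $\mathbb{N}_m$, $m\ge1$, has as row $\boldsymbol{c}_i$ the base-2 representation of $i$, most significant bit first. - The binary semi-Gray code (BSGC) $\mathbb{S}_m$, $m\ge3$, is obtained from $\mathbb{G}_m$ by replacing the first column by the modulo-2 sum of the first and last columns. - The folded binary code (FBC) $\mathbb{F}_m$, $m\ge2$, is one reflection of $\mathbb{N}_{m-1}$. Constellations. $\Omega=[\mathbb{X},\mathbb{L},\mathbb{U}_M]$, where $\mathbb{X}$ has rows $\boldsymbol{x}_0,\ldots,\boldsymbol{x}_{M-1}\in\mathbb{R}^N$, denotes the constellation in which the bits $C_0,\ldots,C_{m-1}$ are independent and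 uniform on $\{0,1\}$ and the transmitted symbol is $\boldsymbol{X}=\boldsymbol{x}_i$ when $[C_0,\ldots,C_{m-1}]=\boldsymbol{c}_i$. Put $E_s=\mathbb{E}[\|\boldsymbol{X}\|^2]$. Channel. $\boldsymbol{Y}=\boldsymbol{H}\circ\boldsymbol{X}+\boldsymbol{Z}$, where $\circ$ is the element-wise product, $\boldsymbol{X},\boldsymbol{H},\boldsymbol{Z}$ are mutually independent, $\boldsymbol{Z}$ is Gaussian in $\mathbb{R}^N$ with independent zero-mean components of variance $N_0/2$, and $\boldsymbol{H}$ is a real random vector whose $N$ components (possibly dependent) all have the same distribution, that of a random variable $H$, with $0<\mathbb{E}[H^2]<\infty$. It is assumed that there is $\omega>0$ such that $\Pr\{\|\boldsymbol{H}\|^2>\Delta\}\le\exp(-\Delta^\omega)$ for all sufficiently large $\Delta>0$. $\boldsymbol{H}$ and $N_0$ are known at the receiver. Define $\mathsf{SNR}=\mathbb{E}[H^2]\,E_s/N_0$; the constellation and the law of $\boldsymbol{H}$ are fixed and $N_0$ varies over $(0,\infty)$, so $\mathsf{SNR}\to0$ means $N_0\to\infty$. BICM capacity (in bits). $\mathsf{I}^{\mathrm{BI}}_\Omega(\mathsf{SNR})=\sum_{k=0}^{m-1}\mathbb{E}\left[\log_2\frac{p_{\boldsymbol{Y}|C_k,\boldsymbol{H}}(\boldsymbol{Y})}{p_{\boldsymbol{Y}|\boldsymbol{H}}(\boldsymbol{Y})}\right]$. The coefficient $\alpha^{\mathrm{BI}}_\Omega$ is defined by $\mathsf{I}^{\mathrm{BI}}_\Omega(\mathsf{SNR})=\alpha^{\mathrm{BI}}_\Omega\,\mathsf{SNR}+O(\mathsf{SNR}^2)$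 as $\mathsf{SNR}\to 0$. *)

theory Defs
  imports "HOL-Probability.Probability" "HOL-Library.Landau_Symbols"
begin

section \<open>Alphabet and labelings\<close>

definition pam :: "nat \<Rightarrow> real list" where
  "pam M = map (\<lambda>i. - (real M - 2 * real i - 1)) [0..<M]"

text \<open>A binary matrix is the list of its rows; \<open>False\<close> and \<open>True\<close> are the bits 0 and 1.\<close>

type_synonym bit_matrix = "bool list list"

definition is_labeling :: "nat \<Rightarrow> bit_matrix \<Rightarrow> bool" where
  "is_labeling m L \<longleftrightarrow> distinct L \<and> set L = {c. length c = m}"

definition reflection :: "bit_matrix \<Rightarrow> bit_matrix" where
  "reflection L = map ((#) False) L @ map ((#) True) (rev L)"

definition brgc :: "nat \<Rightarrow> bit_matrix" where
  "brgc m = (reflection ^^ (m - 1)) [[False], [True]]"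

text \<open>\<open>bit i j\<close> is the coefficient of \<open>2 ^ j\<close> in \<open>i\<close>, so column \<open>j = 0\<close> is the most
  significant bit.\<close>

definition nbc :: "nat \<Rightarrow> bit_matrix" where
  "nbc m = map (\<lambda>i. map (\<lambda>j. bit i (m - 1 - j)) [0..<m]) [0..<2 ^ m]"

definition bsgc :: "nat \<Rightarrow> bit_matrix" where
  "bsgc m = map (\<lambda>c. (hd c \<noteq> last c) # tl c) (brgc m)"

definition fbc :: "nat \<Rightarrow> bit_matrix" where
  "fbc m = reflection (nbc (m - 1))"

lemma card_bit_vectors: "card {c :: bool list. length c = m} = 2 ^ m"
  using card_lists_length_eq[of "UNIV :: bool set" m] by simp

lemma finite_bit_vectors [simp]: "finite {c :: bool list. length c = m}"
  using finite_lists_length_eq[of "UNIV :: bool set" m] by simp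

lemma is_labelingI:
  assumes "distinct L" "length L = 2 ^ m" "\<And>c. c \<in> set L \<Longrightarrow> length c = m"
  shows "is_labeling m L"
proof -
  have "set L = {c. length c = m}"
    using assms by (intro card_subset_eq) (auto simp: card_bit_vectors distinct_card)
  then show ?thesis using assms by (simp add: is_labeling_def)
qed

lemma is_labelingD:
  assumes "is_labeling m L"
  shows "distinct L" "length L = 2 ^ m" "c \<in> set L \<Longrightarrow> length c = m"
  using assms card_bit_vectors[of m] by (auto simp: is_labeling_def dest: distinct_card)

lemma is_labeling_reflection:
  assumes "is_labeling m L"
  shows "is_labeling (Suc m) (reflection L)"
  using is_labelingD[OF assms]
  by (intro is_labelingI) (auto simp: reflection_def distinct_map)

lemma is_labeling_brgc:
  assumes "1 \<le> m"
  shows "is_labeling m (brgc m)"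
proof -
  have "is_labeling (Suc n) ((reflection ^^ n) [[False], [True]])" for n
  proof (induction n)
    case 0
    show ?case by (rule is_labelingI) auto
  next
    case (Suc n)
    then show ?case by (simp add: is_labeling_reflection)
  qed
  from this[of "m - 1"] assms show ?thesis by (simp add: brgc_def)
qed

lemma is_labeling_nbc: "is_labeling m (nbc m)"
proof (rule is_labelingI)
  have "inj_on (\<lambda>i. map (\<lambda>j. bit i (m - 1 - j)) [0..<m]) {0..<2 ^ m :: nat}"
  proof (rule inj_onI)
    fix a b :: nat
    assume a: "a \<in> {0..<2 ^ m}" and b: "b \<in> {0..<2 ^ m}"
      and eq: "map (\<lambda>j. bit a (m - 1 - j)) [0..<m] = map (\<lambda>j. bit b (m - 1 - j)) [0..<m]"
    have low: "bit a n = bit b n" if "n < m" for n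
    proof -
      have "bit a (m - 1 - (m - 1 - n)) = bit b (m - 1 - (m - 1 - n))"
      proof -
        have "map (\<lambda>j. bit a (m - 1 - j)) [0..<m] ! (m - 1 - n) =
            map (\<lambda>j. bit b (m - 1 - j)) [0..<m] ! (m - 1 - n)"
          by (simp only: eq)
        then show ?thesis using that by simp
      qed
      with that show ?thesis by simp
    qed
    have "take_bit m a = take_bit m b"
      by (rule bit_eqI) (auto simp: bit_take_bit_iff low)
    then show "a = b" using a b by (simp add: take_bit_nat_eq_self)
  qed
  then show "distinct (nbc m)" by (simp add: nbc_def distinct_map)
qed (auto simp: nbc_def)

lemma is_labeling_fbc:
  assumes "1 \<le> m"
  shows "is_labeling m (fbc m)"
  using is_labeling_reflection[OF is_labeling_nbc[of "m - 1"]] assms by (simp add: fbc_def)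

lemma is_labeling_bsgc:
  assumes "2 \<le> m"
  shows "is_labeling m (bsgc m)"
proof (rule is_labelingI)
  have L: "is_labeling m (brgc m)" using assms by (intro is_labeling_brgc) simp
  note D = is_labelingD[OF L]
  have "inj_on (\<lambda>c. (hd c \<noteq> last c) # tl c) (set (brgc m))"
  proof (rule inj_onI)
    fix c d assume c: "c \<in> set (brgc m)" and d: "d \<in> set (brgc m)"
      and eq: "(hd c \<noteq> last c) # tl c = (hd d \<noteq> last d) # tl d"
    obtain a cs where c': "c = a # cs" "cs \<noteq> []"
      using D(3)[OF c] assms by (cases c) (fastforce simp: Suc_le_eq)+
    obtain b ds where d': "d = b # ds" "ds \<noteq> []"
      using D(3)[OF d] assms by (cases d) (fastforce simp: Suc_le_eq)+
    show "c = d" using eq c' d' by auto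
  qed
  then show "distinct (bsgc m)" using D(1) by (simp add: bsgc_def distinct_map)
  show "length (bsgc m) = 2 ^ m" using D(2) by (simp add: bsgc_def)
  show "length c = m" if "c \<in> set (bsgc m)" for c
    using that D(3) assms by (fastforce simp: bsgc_def)
qed

section \<open>Constellation with uniform bits\<close>

text \<open>The vector of \<open>m\<close> independent uniform bits.\<close>

definition bits_pmf :: "nat \<Rightarrow> bool list pmf" where
  "bits_pmf m = pmf_of_set {c. length c = m}"

definition symbol :: "real list \<Rightarrow> bit_matrix \<Rightarrow> bool list \<Rightarrow> real" where
  "symbol xs L c = xs ! (THE i. i < length L \<and> L ! i = c)"

lemma symbol_nth:
  assumes "distinct L" "i < length L"
  shows "symbol xs L (L ! i) = xs ! i"
proof -
  have "(THE j. j < length L \<and> L ! j = L ! i) = i"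
    using assms by (intro the_equality) (auto simp: nth_eq_iff_index_eq)
  then show ?thesis by (simp add: symbol_def)
qed

definition symbol_energy :: "nat \<Rightarrow> real list \<Rightarrow> bit_matrix \<Rightarrow> real" where
  "symbol_energy m xs L = measure_pmf.expectation (bits_pmf m) (\<lambda>c. (symbol xs L c)\<^sup>2)"

section \<open>Fading channel\<close>

text \<open>Symbols are real (dimension one), \<open>\<nu>\<close> is the law of the fading coefficient \<open>H\<close>, and the
  noise \<open>Z\<close> has variance \<open>N0 / 2\<close>. By independence the joint law of bits, fading and noise is a
  product measure; an outcome is a triple \<open>(c, h, z)\<close>, with channel output
  \<open>h * symbol xs L c + z\<close>.\<close>

definition channel :: "nat \<Rightarrow> real measure \<Rightarrow> real \<Rightarrow> (bool list \<times> real \<times> real) measure" where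
  "channel m \<nu> N0 =
     measure_pmf (bits_pmf m) \<Otimes>\<^sub>M (\<nu> \<Otimes>\<^sub>M density lborel (normal_density 0 (sqrt (N0 / 2))))"

definition snr :: "nat \<Rightarrow> real list \<Rightarrow> bit_matrix \<Rightarrow> real measure \<Rightarrow> real \<Rightarrow> real" where
  "snr m xs L \<nu> N0 = (\<integral>h. h\<^sup>2 \<partial>\<nu>) * symbol_energy m xs L / N0"

text \<open>Density at \<open>y\<close> of the output given \<open>H = h\<close> when the bit vector has law \<open>p\<close>.\<close>

definition output_density ::
    "bool list pmf \<Rightarrow> real list \<Rightarrow> bit_matrix \<Rightarrow> real \<Rightarrow> real \<Rightarrow> real \<Rightarrow> real" where
  "output_density p xs L N0 h y =
     measure_pmf.expectation p (\<lambda>c. normal_density (h * symbol xs L c) (sqrt (N0 / 2)) y)"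

definition density_given_H ::
    "nat \<Rightarrow> real list \<Rightarrow> bit_matrix \<Rightarrow> real \<Rightarrow> real \<Rightarrow> real \<Rightarrow> real" where
  "density_given_H m xs L N0 h y = output_density (bits_pmf m) xs L N0 h y"

definition density_given_bit_H ::
    "nat \<Rightarrow> real list \<Rightarrow> bit_matrix \<Rightarrow> real \<Rightarrow> nat \<Rightarrow> bool \<Rightarrow> real \<Rightarrow> real \<Rightarrow> real" where
  "density_given_bit_H m xs L N0 k u h y =
     output_density (cond_pmf (bits_pmf m) {c. c ! k = u}) xs L N0 h y"

text \<open>The next three lemmas show that these functions are the conditional densities of the
  output under \<open>channel\<close>.\<close>

lemma set_bits_pmf: "set_pmf (bits_pmf m) = {c. length c = m}"
  unfolding bits_pmf_def
  by (rule set_pmf_of_set) (auto intro: exI[of _ "replicate m False"])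

lemma finite_set_bits_pmf [simp]: "finite (set_pmf (bits_pmf m))"
  by (simp add: set_bits_pmf)

lemma bit_set_meets_bits_pmf:
  assumes "k < m"
  shows "set_pmf (bits_pmf m) \<inter> {c. c ! k = u} \<noteq> {}"
proof -
  have "replicate m u \<in> set_pmf (bits_pmf m) \<inter> {c. c ! k = u}"
    using assms by (simp add: set_bits_pmf)
  then show ?thesis by blast
qed

lemma ennreal_output_density:
  assumes "finite (set_pmf p)"
  shows "ennreal (output_density p xs L N0 h y) =
    (\<integral>\<^sup>+c. ennreal (normal_density (h * symbol xs L c) (sqrt (N0 / 2)) y) \<partial>measure_pmf p)"
  unfolding output_density_def
  by (rule nn_integral_eq_integral[symmetric])
    (auto intro: integrable_measure_pmf_finite assms)

lemma nn_integral_cond_pmf: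
  assumes "set_pmf p \<inter> S \<noteq> {}"
  shows "(\<integral>\<^sup>+c. f c * indicator S c \<partial>measure_pmf p) =
    ennreal (measure_pmf.prob p S) * (\<integral>\<^sup>+c. f c \<partial>measure_pmf (cond_pmf p S))"
proof -
  have pos: "0 < measure_pmf.prob p S"
    using assms by (auto intro: measure_pmf_posI)
  have "ennreal (measure_pmf.prob p S) * (\<integral>\<^sup>+c. f c \<partial>measure_pmf (cond_pmf p S)) =
      (\<integral>\<^sup>+c. ennreal (measure_pmf.prob p S) * (ennreal (pmf (cond_pmf p S) c) * f c)
        \<partial>count_space UNIV)"
    by (simp add: nn_integral_measure_pmf nn_integral_cmult)
  also have "\<dots> = (\<integral>\<^sup>+c. ennreal (pmf p c) * (f c * indicator S c) \<partial>count_space UNIV)"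
    using pos
    by (intro nn_integral_cong)
      (auto simp: pmf_cond[OF assms] mult.assoc[symmetric] ennreal_mult[symmetric] split: split_indicator)
  finally show ?thesis by (simp add: nn_integral_measure_pmf)
qed

lemma emeasure_channel_given_bits:
  assumes \<nu>: "real_distribution \<nu>" and N0: "0 < N0"
    and A: "A \<in> sets borel" and B: "B \<in> sets borel"
    and S: "set_pmf (bits_pmf m) \<inter> S \<noteq> {}"
  shows "emeasure (channel m \<nu> N0) {(c, h, z). c \<in> S \<and> h \<in> B \<and> h * symbol xs L c + z \<in> A} =
    ennreal (measure_pmf.prob (bits_pmf m) S) *
      (\<integral>\<^sup>+h. (\<integral>\<^sup>+y. ennreal (output_density (cond_pmf (bits_pmf m) S) xs L N0 h y)
         * indicator A y \<partial>lborel) * indicator B h \<partial>\<nu>)"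
proof -
  interpret \<nu>: real_distribution \<nu> by (rule \<nu>)
  note [measurable] = A B
  let ?\<sigma> = "sqrt (N0 / 2)"
  let ?g = "density lborel (normal_density 0 ?\<sigma>)"
  let ?p = "bits_pmf m" and ?q = "cond_pmf (bits_pmf m) S"
  let ?s = "symbol xs L"
  let ?E = "{(c, h, z). c \<in> S \<and> h \<in> B \<and> h * ?s c + z \<in> A}"
  have \<sigma>: "0 < ?\<sigma>" using N0 by simp
  interpret g: prob_space ?g using \<sigma> by (rule prob_space_normal_density)
  interpret gs: pair_sigma_finite \<nu> ?g ..
  have E: "?E \<in> sets (channel m \<nu> N0)"
  proof -
    have "(\<lambda>(c, h, z). c \<in> S \<and> h \<in> B \<and> h * ?s c + z \<in> A)
      \<in> measurable (count_space UNIV \<Otimes>\<^sub>M (borel \<Otimes>\<^sub>M borel)) (count_space UNIV)"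
      unfolding case_prod_unfold
      by (rule measurable_compose_countable'[where I = UNIV and g = fst
          and f = "\<lambda>c w. c \<in> S \<and> fst (snd w) \<in> B \<and> fst (snd w) * ?s c + snd (snd w) \<in> A"]) auto
    then have "{w \<in> space (count_space UNIV \<Otimes>\<^sub>M (borel \<Otimes>\<^sub>M borel)).
        (\<lambda>(c, h, z). c \<in> S \<and> h \<in> B \<and> h * ?s c + z \<in> A) w}
      \<in> sets (count_space UNIV \<Otimes>\<^sub>M ((borel :: real measure) \<Otimes>\<^sub>M (borel :: real measure)))"
      by measurable
    moreover have "sets (channel m \<nu> N0) =
        sets (count_space UNIV \<Otimes>\<^sub>M ((borel :: real measure) \<Otimes>\<^sub>M (borel :: real measure)))"
      unfolding channel_def by (intro sets_pair_measure_cong) auto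
    ultimately show ?thesis
      by (auto simp: space_pair_measure Collect_case_prod case_prod_unfold)
  qed
  have shift: "(\<integral>\<^sup>+z. indicator A (a + z) \<partial>?g) =
      (\<integral>\<^sup>+y. ennreal (normal_density a ?\<sigma> y) * indicator A y \<partial>lborel)" for a
  proof -
    have "(\<integral>\<^sup>+z. indicator A (a + z) \<partial>?g) =
        (\<integral>\<^sup>+z. ennreal (normal_density 0 ?\<sigma> z) * indicator A (a + z) \<partial>lborel)"
      by (rule nn_integral_density) auto
    also have "\<dots> = (\<integral>\<^sup>+z. ennreal (normal_density a ?\<sigma> (a + z)) * indicator A (a + z) \<partial>lborel)"
      by (simp add: normal_density_def)
    also have "\<dots> = (\<integral>\<^sup>+y. ennreal (normal_density a ?\<sigma> y) * indicator A y \<partial>distr lborel borel ((+) a))"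
      by (rule nn_integral_distr[symmetric]) auto
    finally show ?thesis by (simp add: lborel_distr_plus)
  qed
  have joint: "(\<integral>\<^sup>+w. indicator ?E (c, w) \<partial>(\<nu> \<Otimes>\<^sub>M ?g)) =
      (\<integral>\<^sup>+h. (\<integral>\<^sup>+y. ennreal (normal_density (h * ?s c) ?\<sigma> y) * indicator A y \<partial>lborel)
        * indicator B h \<partial>\<nu>) * indicator S c" for c
  proof -
    have "(\<integral>\<^sup>+w. indicator ?E (c, w) \<partial>(\<nu> \<Otimes>\<^sub>M ?g)) =
        (\<integral>\<^sup>+w. (case w of (h, z) \<Rightarrow> indicator A (h * ?s c + z) * indicator B h * indicator S c)
          \<partial>(\<nu> \<Otimes>\<^sub>M ?g))"
      by (intro nn_integral_cong) (auto simp: indicator_def)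
    also have "\<dots> = (\<integral>\<^sup>+h. (\<integral>\<^sup>+z. indicator A (h * ?s c + z) * indicator B h * indicator S c \<partial>?g) \<partial>\<nu>)"
      by (subst g.nn_integral_fst[symmetric]) auto
    also have "\<dots> = (\<integral>\<^sup>+h. (\<integral>\<^sup>+z. indicator A (h * ?s c + z) \<partial>?g) * indicator B h * indicator S c \<partial>\<nu>)"
      by (simp add: nn_integral_multc)
    also have "\<dots> = (\<integral>\<^sup>+h. (\<integral>\<^sup>+z. indicator A (h * ?s c + z) \<partial>?g) * indicator B h \<partial>\<nu>) * indicator S c"
      by (rule nn_integral_multc) auto
    finally show ?thesis by (simp only: shift)
  qed
  have swap1: "(\<integral>\<^sup>+c. f c \<partial>measure_pmf ?q) = (\<Sum>c\<in>set_pmf ?q. f c * ennreal (pmf ?q c))" for f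
    by (rule nn_integral_measure_pmf_finite) (auto simp: set_cond_pmf[OF S])
  have meas [measurable]: "(\<lambda>h. \<integral>\<^sup>+y. ennreal (normal_density (h * ?s c) ?\<sigma> y)
      * indicator A y \<partial>lborel) \<in> borel_measurable \<nu>" for c
    unfolding normal_density_def by measurable
  have inner: "(\<integral>\<^sup>+y. (\<Sum>c\<in>set_pmf ?q. ennreal (normal_density (h * ?s c) ?\<sigma> y) * ennreal (pmf ?q c))
        * indicator A y \<partial>lborel) =
      (\<Sum>c\<in>set_pmf ?q. (\<integral>\<^sup>+y. ennreal (normal_density (h * ?s c) ?\<sigma> y) * indicator A y \<partial>lborel)
        * ennreal (pmf ?q c))" for h
  proof -
    have "(\<integral>\<^sup>+y. (\<Sum>c\<in>set_pmf ?q. ennreal (normal_density (h * ?s c) ?\<sigma> y) * ennreal (pmf ?q c))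
        * indicator A y \<partial>lborel) =
      (\<integral>\<^sup>+y. (\<Sum>c\<in>set_pmf ?q. (ennreal (normal_density (h * ?s c) ?\<sigma> y) * indicator A y)
        * ennreal (pmf ?q c)) \<partial>lborel)"
      by (simp only: sum_distrib_right sum_distrib_left mult_ac)
    also have "\<dots> = (\<Sum>c\<in>set_pmf ?q. \<integral>\<^sup>+y. (ennreal (normal_density (h * ?s c) ?\<sigma> y)
        * indicator A y) * ennreal (pmf ?q c) \<partial>lborel)"
      by (rule nn_integral_sum) measurable
    also have "\<dots> = (\<Sum>c\<in>set_pmf ?q. (\<integral>\<^sup>+y. ennreal (normal_density (h * ?s c) ?\<sigma> y)
        * indicator A y \<partial>lborel) * ennreal (pmf ?q c))"
      by (intro sum.cong refl nn_integral_multc) measurable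
    finally show ?thesis .
  qed
  have outer: "(\<Sum>c\<in>C. (\<integral>\<^sup>+h. F c h * indicator B h \<partial>\<nu>) * w c) =
      (\<integral>\<^sup>+h. (\<Sum>c\<in>C. F c h * w c) * indicator B h \<partial>\<nu>)"
    if [measurable]: "\<And>c. F c \<in> borel_measurable \<nu>"
    for C and F :: "bool list \<Rightarrow> real \<Rightarrow> ennreal" and w :: "bool list \<Rightarrow> ennreal"
  proof -
    have "(\<integral>\<^sup>+h. (\<Sum>c\<in>C. F c h * w c) * indicator B h \<partial>\<nu>) =
        (\<integral>\<^sup>+h. (\<Sum>c\<in>C. (F c h * indicator B h) * w c) \<partial>\<nu>)"
      by (simp only: sum_distrib_right sum_distrib_left mult_ac)
    also have "\<dots> = (\<Sum>c\<in>C. \<integral>\<^sup>+h. (F c h * indicator B h) * w c \<partial>\<nu>)"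
      by (rule nn_integral_sum) measurable
    also have "\<dots> = (\<Sum>c\<in>C. (\<integral>\<^sup>+h. F c h * indicator B h \<partial>\<nu>) * w c)"
      by (intro sum.cong refl nn_integral_multc) measurable
    finally show ?thesis by simp
  qed
  have "emeasure (channel m \<nu> N0) ?E =
      (\<integral>\<^sup>+c. (\<integral>\<^sup>+w. indicator ?E (c, w) \<partial>(\<nu> \<Otimes>\<^sub>M ?g)) \<partial>measure_pmf ?p)"
    using E unfolding channel_def 
    by (intro sigma_finite_measure.emeasure_pair_measure prob_space_imp_sigma_finite
        prob_space_pair \<nu>.prob_space_axioms g.prob_space_axioms)
  also have "\<dots> = ennreal (measure_pmf.prob ?p S) *
      (\<integral>\<^sup>+c. (\<integral>\<^sup>+h. (\<integral>\<^sup>+y. ennreal (normal_density (h * ?s c) ?\<sigma> y) * indicator A y \<partial>lborel)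
        * indicator B h \<partial>\<nu>) \<partial>measure_pmf ?q)"
    unfolding joint by (rule nn_integral_cond_pmf[OF S])
  also have "(\<integral>\<^sup>+c. (\<integral>\<^sup>+h. (\<integral>\<^sup>+y. ennreal (normal_density (h * ?s c) ?\<sigma> y) * indicator A y \<partial>lborel)
        * indicator B h \<partial>\<nu>) \<partial>measure_pmf ?q) =
      (\<integral>\<^sup>+h. (\<integral>\<^sup>+y. (\<integral>\<^sup>+c. ennreal (normal_density (h * ?s c) ?\<sigma> y) \<partial>measure_pmf ?q)
        * indicator A y \<partial>lborel) * indicator B h \<partial>\<nu>)"
    unfolding swap1 inner by (rule outer) (rule meas)
  finally show ?thesis
    by (simp add: ennreal_output_density set_cond_pmf[OF S])
qed

lemma emeasure_channel_given_H:
  assumes "real_distribution \<nu>" "0 < N0" "A \<in> sets borel" "B \<in> sets borel"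
  shows "emeasure (channel m \<nu> N0) {(c, h, z). h \<in> B \<and> h * symbol xs L c + z \<in> A} =
    (\<integral>\<^sup>+h. (\<integral>\<^sup>+y. ennreal (density_given_H m xs L N0 h y) * indicator A y \<partial>lborel)
      * indicator B h \<partial>\<nu>)"
proof -
  have ne: "set_pmf (bits_pmf m) \<inter> UNIV \<noteq> {}" by (simp add: set_pmf_not_empty)
  have "cond_pmf (bits_pmf m) UNIV = bits_pmf m"
    by (rule pmf_eqI) (simp add: pmf_cond[OF ne])
  then show ?thesis
    using emeasure_channel_given_bits[OF assms ne, of xs L] by (simp add: density_given_H_def)
qed

lemma emeasure_channel_given_bit_H:
  assumes "real_distribution \<nu>" "0 < N0" "A \<in> sets borel" "B \<in> sets borel" "k < m"
  shows "emeasure (channel m \<nu> N0) {(c, h, z). c ! k = u \<and> h \<in> B \<and> h * symbol xs L c + z \<in> A} =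
    ennreal (measure_pmf.prob (bits_pmf m) {c. c ! k = u}) *
      (\<integral>\<^sup>+h. (\<integral>\<^sup>+y. ennreal (density_given_bit_H m xs L N0 k u h y) * indicator A y \<partial>lborel)
        * indicator B h \<partial>\<nu>)"
  using emeasure_channel_given_bits[OF assms(1-4) bit_set_meets_bits_pmf[OF assms(5)], of u xs L]
  by (simp add: density_given_bit_H_def)

section \<open>BICM capacity and its first-order coefficient\<close>

definition bicm_capacity ::
    "nat \<Rightarrow> real list \<Rightarrow> bit_matrix \<Rightarrow> real measure \<Rightarrow> real \<Rightarrow> real" where
  "bicm_capacity m xs L \<nu> N0 =
     (\<Sum>k<m. \<integral>(c, h, z).
        (let y = h * symbol xs L c + z
         in log 2 (density_given_bit_H m xs L N0 k (c ! k) h y / density_given_H m xs L N0 h y))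
        \<partial>channel m \<nu> N0)"

text \<open>The signal-to-noise ratio tends to 0 as \<open>N0\<close> tends to infinity, the constellation and \<open>\<nu>\<close>
  being fixed.\<close>

definition is_bicm_coefficient ::
    "nat \<Rightarrow> real list \<Rightarrow> bit_matrix \<Rightarrow> real measure \<Rightarrow> real \<Rightarrow> bool" where
  "is_bicm_coefficient m xs L \<nu> \<alpha> \<longleftrightarrow>
     (\<lambda>N0. bicm_capacity m xs L \<nu> N0 - \<alpha> * snr m xs L \<nu> N0)
       \<in> O[at_top](\<lambda>N0. (snr m xs L \<nu> N0)\<^sup>2)"

definition bicm_coefficient ::
    "nat \<Rightarrow> real list \<Rightarrow> bit_matrix \<Rightarrow> real measure \<Rightarrow> real" where
  "bicm_coefficient m xs L \<nu> = (THE \<alpha>. is_bicm_coefficient m xs L \<nu> \<alpha>)"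

lemma is_bicm_coefficient_unique:
  assumes "0 < (\<integral>h. h\<^sup>2 \<partial>\<nu>)" "0 < symbol_energy m xs L"
    and "is_bicm_coefficient m xs L \<nu> \<alpha>" "is_bicm_coefficient m xs L \<nu> \<beta>"
  shows "\<alpha> = \<beta>"
proof (rule ccontr)
  assume ne: "\<alpha> \<noteq> \<beta>"
  define K where "K = (\<integral>h. h\<^sup>2 \<partial>\<nu>) * symbol_energy m xs L"
  have K: "0 < K" using assms by (simp add: K_def)
  have s: "snr m xs L \<nu> = (\<lambda>N0. K / N0)" by (simp add: snr_def K_def fun_eq_iff)
  have "(\<lambda>N0. (\<beta> - \<alpha>) * (K / N0)) \<in> O[at_top](\<lambda>N0. (K / N0)\<^sup>2)"
  proof -
    have "(\<beta> - \<alpha>) * (K / N0) = (bicm_capacity m xs L \<nu> N0 - \<alpha> * (K / N0)) -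
        (bicm_capacity m xs L \<nu> N0 - \<beta> * (K / N0))" for N0
      by (simp add: left_diff_distrib diff_divide_distrib)
    then show ?thesis
      using sum_in_bigo(2)[OF assms(3,4)[unfolded is_bicm_coefficient_def s]] by simp
  qed
  then obtain c where c: "\<forall>\<^sub>F N0 in at_top. norm ((\<beta> - \<alpha>) * (K / N0)) \<le> c * norm ((K / N0)\<^sup>2)"
    by (auto elim!: landau_o.bigE)
  have "\<forall>\<^sub>F N0 in at_top. \<bar>\<beta> - \<alpha>\<bar> \<le> c * (K / N0)"
    using c eventually_gt_at_top[of 0]
  proof eventually_elim
    case (elim N)
    then have "\<bar>\<beta> - \<alpha>\<bar> * (K / N) \<le> c * (K / N) * (K / N)"
      using K by (simp add: abs_mult power2_eq_square mult_ac)
    moreover have "0 < K / N" using elim K by simp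
    ultimately show ?case by (simp only: mult_le_cancel_right_pos)
  qed
  moreover have "((\<lambda>N0. c * (K / N0)) \<longlongrightarrow> c * 0) at_top"
    by (intro tendsto_intros tendsto_divide_0[OF tendsto_const])
      (simp add: filterlim_at_top_imp_at_infinity filterlim_ident)
  ultimately have "\<bar>\<beta> - \<alpha>\<bar> \<le> c * 0"
    by (intro tendsto_le[OF trivial_limit_at_top_linorder _ tendsto_const])
  with ne show False by simp
qed

end

theory Submission
  imports Defs "HOL-Real_Asymp.Real_Asymp"
begin

text \<open>Given \<open>H = h\<close>, divide all output densities by the noise density: a conditional law of the
  symbol \<open>x\<close> turns into a mixture \<open>F\<close> of exponential tilts, and the mutual information of one bit is
  the average over its two values of \<open>\<integral> \<phi> F ln F\<close>, minus the same quantity for the unconditioned law.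
  Expanding \<open>F ln F\<close> around \<open>F = 1\<close> to fourth order reduces \<open>\<integral> \<phi> F ln F\<close> to the first four moments of
  \<open>F\<close>, which are finite sums of exponentials; the result is \<open>(E x)\<^sup>2 \<theta> / 2 + O(\<theta>\<^sup>2)\<close>
  uniformly in \<open>\<theta> = h\<^sup>2 / \<sigma>\<^sup>2\<close>. Integrating over \<open>h\<close> only needs a finite fourth moment, which
  the tail condition supplies. So the coefficient depends only on the conditional symbol means given
  each bit, i.e. on the correlations of the columns with the alphabet, and a reflection
  makes every column but the first orthogonal to it.\<close>

section \<open>Expansion of the relative entropy\<close>

text \<open>The mean value theorem between 0 and \<open>v\<close> suffices, since \<open>f'\<close>
  has the sign of its argument. Both logarithm bounds below thereby reduce to the sign of one
  derivative.\<close>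

lemma ge_at_zero_of_deriv_sign:
  fixes f f' :: "real \<Rightarrow> real"
  assumes deriv: "\<And>u. -1 < u \<Longrightarrow> (f has_real_derivative f' u) (at u)"
    and sign: "\<And>u. -1 < u \<Longrightarrow> 0 \<le> u * f' u"
    and v: "-1 < v"
  shows "f 0 \<le> f v"
proof (cases v "0 :: real" rule: linorder_cases)
  case less
  obtain z where z: "v < z" "z < 0" "f 0 - f v = (0 - v) * f' z"
    using MVT2[OF less, of f f'] deriv v by (metis less_le_trans)
  then have "f' z \<le> 0" using sign[of z] v by (simp add: zero_le_mult_iff)
  then have "(0 - v) * f' z \<le> 0" using less by (simp add: mult_nonneg_nonpos2 zero_le_mult_iff)
  then show ?thesis using z by linarith
next
  case greater
  obtain z where z: "0 < z" "z < v" "f v - f 0 = (v - 0) * f' z"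
    using MVT2[OF greater, of f f'] deriv by (metis less_le_trans less_trans zero_less_one neg_less_0_iff_less)
  then have "0 \<le> f' z" using sign[of z] by (simp add: zero_le_mult_iff)
  then have "0 \<le> (v - 0) * f' z" using greater by simp
  then show ?thesis using z by linarith
qed simp

text \<open>The cubic Taylor polynomial of \<open>ln (1 + u)\<close> exceeds it by a function with
  derivative \<open>u ^ 3 / (1 + u)\<close>, which has the sign of \<open>u\<close>; the factor
  \<open>1 + u\<close> then raises the degree to four.\<close>

lemma mult_ln_le_quartic:
  fixes u :: real
  assumes "-1 < u"
  shows "(1 + u) * ln (1 + u) \<le> u + u\<^sup>2 / 2 - u ^ 3 / 6 + u ^ 4 / 3"
proof -
  have "0 - 0\<^sup>2 / 2 + 0 ^ 3 / 3 - ln (1 + 0) \<le> u - u\<^sup>2 / 2 + u ^ 3 / 3 - ln (1 + u)"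
  proof (rule ge_at_zero_of_deriv_sign[OF _ _ assms])
    fix v :: real assume v: "-1 < v"
    show "((\<lambda>u. u - u\<^sup>2 / 2 + u ^ 3 / 3 - ln (1 + u)) has_real_derivative v ^ 3 / (1 + v)) (at v)"
      using v by (auto intro!: derivative_eq_intros simp: field_simps power2_eq_square power3_eq_cube)
    have "v * (v ^ 3 / (1 + v)) = (v\<^sup>2)\<^sup>2 / (1 + v)"
      by (simp add: power2_eq_square power3_eq_cube)
    then show "0 \<le> v * (v ^ 3 / (1 + v))" using v by simp
  qed
  then have "ln (1 + u) \<le> u - u\<^sup>2 / 2 + u ^ 3 / 3" by simp
  then have "(1 + u) * ln (1 + u) \<le> (1 + u) * (u - u\<^sup>2 / 2 + u ^ 3 / 3)"
    using assms by (intro mult_left_mono) auto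
  also have "\<dots> = u + u\<^sup>2 / 2 - u ^ 3 / 6 + u ^ 4 / 3"
    by (simp add: field_simps power2_eq_square power3_eq_cube power4_eq_xxxx)
  finally show ?thesis .
qed

lemma mult_ln_ge_cubic:
  fixes u :: real
  assumes "-1 < u"
  shows "u + u\<^sup>2 / 2 - u ^ 3 / 6 \<le> (1 + u) * ln (1 + u)"
proof -
  \<comment> \<open>The last term becomes the polynomial \<open>u ^ 4 / 3\<close> after multiplication by \<open>1 + u\<close> and makes
    the derivative collapse to a single term.\<close>
  let ?f = "\<lambda>u::real. ln (1 + u) - u + u\<^sup>2 / 2 - u ^ 3 / 3 + u ^ 4 / (3 * (1 + u))"
  have "?f 0 \<le> ?f u"
  proof (rule ge_at_zero_of_deriv_sign[OF _ _ assms])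
    fix v :: real assume v: "-1 < v"
    then have nz: "1 + v \<noteq> 0" by simp
    have eq: "1 / (1 + v) - 1 + v - v\<^sup>2 + (4 * v ^ 3 * (3 * (1 + v)) - v ^ 4 * 3) / (3 * (1 + v))\<^sup>2
        = v ^ 3 / (3 * (1 + v)\<^sup>2)"
      using nz by (simp add: divide_simps) algebra
    have "(?f has_real_derivative
        1 / (1 + v) - 1 + v - v\<^sup>2 + (4 * v ^ 3 * (3 * (1 + v)) - v ^ 4 * 3) / (3 * (1 + v))\<^sup>2) (at v)"
      using v nz by (auto intro!: derivative_eq_intros simp: power2_eq_square power3_eq_cube)
    then show "(?f has_real_derivative v ^ 3 / (3 * (1 + v)\<^sup>2)) (at v)" by (simp only: eq)
    have "v * (v ^ 3 / (3 * (1 + v)\<^sup>2)) = (v\<^sup>2)\<^sup>2 / (3 * (1 + v)\<^sup>2)"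
      by (simp add: power2_eq_square power3_eq_cube)
    also have "0 \<le> (v\<^sup>2)\<^sup>2 / (3 * (1 + v)\<^sup>2)" by simp
    finally show "0 \<le> v * (v ^ 3 / (3 * (1 + v)\<^sup>2))" .
  qed
  then have "0 \<le> (1 + u) * ?f u" using assms by simp
  also have "(1 + u) * ?f u = (1 + u) * ln (1 + u) - (u + u\<^sup>2 / 2 - u ^ 3 / 6)"
    using assms by (simp add: field_simps power2_eq_square power3_eq_cube power4_eq_xxxx)
  finally show ?thesis by simp
qed

lemma abs_exp_minus_linear_le:
  fixes s :: real
  assumes "\<bar>s\<bar> \<le> 1"
  shows "\<bar>exp s - (1 + s)\<bar> \<le> s\<^sup>2"
proof -
  have "exp s \<le> 1 + s + s\<^sup>2"
  proof (cases "0 \<le> s")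
    case True
    then show ?thesis using exp_bound[of s] assms by simp
  next
    case False
    \<comment> \<open>For negative \<open>s\<close> both sides are compared after multiplication by
      \<open>1 - s > 0\<close>: the left one is at most 1, the right one is
      \<open>1 - s ^ 3\<close>, which is at least 1.\<close>
    have "exp s * (1 - s) \<le> exp s * exp (- s)"
      using exp_ge_add_one_self[of "- s"] by (intro mult_left_mono) auto
    also have "\<dots> \<le> 1 - s ^ 3" using False by (simp add: exp_minus zero_le_power_eq power_le_zero_eq)
    also have "\<dots> = (1 + s + s\<^sup>2) * (1 - s)"
      by (simp add: algebra_simps power2_eq_square power3_eq_cube)
    finally show ?thesis using False by (simp add: mult_le_cancel_right)
  qed
  then show ?thesis using exp_ge_add_one_self[of s] by linarith
qed


section \<open>Likelihood ratios of Gaussian mixtures against the noise\<close>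

definition tilt :: "real \<Rightarrow> real \<Rightarrow> real \<Rightarrow> real" where
  "tilt \<sigma> b y = exp ((b * y - b\<^sup>2 / 2) / \<sigma>\<^sup>2)"

lemma normal_density_tilt:
  "0 < \<sigma> \<Longrightarrow> normal_density b \<sigma> y = normal_density 0 \<sigma> y * tilt \<sigma> b y"
  by (simp add: normal_density_def tilt_def exp_add[symmetric] field_simps power2_eq_square)

text \<open>Tilts are closed under products up to a constant factor, so powers of a mixture of tilts
  can be integrated exactly.\<close>

lemma tilt_mult: "tilt \<sigma> a y * tilt \<sigma> b y = exp (a * b / \<sigma>\<^sup>2) * tilt \<sigma> (a + b) y"
  unfolding tilt_def exp_add[symmetric] add_divide_distrib[symmetric]
  by (simp add: algebra_simps power2_eq_square add_divide_distrib)

lemma tilt_0 [simp]: "tilt \<sigma> 0 y = 1"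
  by (simp add: tilt_def)

lemma tilt_pos [simp]: "0 < tilt \<sigma> b y"
  by (simp add: tilt_def)

lemma tilt_measurable [measurable]: "tilt \<sigma> b \<in> borel_measurable borel"
  unfolding tilt_def by measurable

text \<open>To be instantiated with the symbol law and with its two conditional laws given one bit.
  They share the bound \<open>B\<close>, so all three get the same error term.\<close>

locale finite_mixture =
  fixes A :: "'a set" and w x :: "'a \<Rightarrow> real" and B :: real
  assumes finite_A [simp]: "finite A"
    and w_nonneg: "c \<in> A \<Longrightarrow> 0 \<le> w c"
    and w_sum: "sum w A = 1"
    and x_bound: "c \<in> A \<Longrightarrow> \<bar>x c\<bar> \<le> B"
    and B_nonneg: "0 \<le> B"
begin

definition mean :: real where
  "mean = (\<Sum>c\<in>A. w c * x c)"

definition lr :: "real \<Rightarrow> real \<Rightarrow> real \<Rightarrow> real" where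
  "lr \<sigma> h y = (\<Sum>c\<in>A. w c * tilt \<sigma> (h * x c) y)"

lemma average_le:
  assumes "\<And>c. c \<in> A \<Longrightarrow> f c \<le> K"
  shows "(\<Sum>c\<in>A. w c * f c) \<le> K"
proof -
  have "(\<Sum>c\<in>A. w c * f c) \<le> (\<Sum>c\<in>A. w c * K)"
    using assms w_nonneg by (intro sum_mono mult_left_mono)
  then show ?thesis by (simp add: sum_distrib_right[symmetric] w_sum)
qed

lemma average_ge:
  assumes "\<And>c. c \<in> A \<Longrightarrow> K \<le> f c"
  shows "K \<le> (\<Sum>c\<in>A. w c * f c)"
  using average_le[of "\<lambda>c. - f c" "- K"] assms by (simp add: sum_negf)

lemma abs_average_le:
  assumes "\<And>c. c \<in> A \<Longrightarrow> \<bar>f c\<bar> \<le> K"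
  shows "\<bar>\<Sum>c\<in>A. w c * f c\<bar> \<le> K"
  using average_le[of f K] average_ge[of "- K" f] assms by (fastforce simp: abs_le_iff)

lemma abs_mean_le: "\<bar>mean\<bar> \<le> B"
  unfolding mean_def by (rule abs_average_le) (rule x_bound)

lemma lr_pos: "0 < lr \<sigma> h y"
proof -
  have "(\<Sum>c\<in>A. w c) \<noteq> 0" by (simp add: w_sum)
  then obtain c where "c \<in> A" "w c \<noteq> 0" by (meson sum.neutral)
  then show ?thesis
    unfolding lr_def using w_nonneg
    by (intro sum_pos2[of A c]) (auto simp: less_le[of 0 "w c"] intro!: mult_nonneg_nonneg mult_pos_pos less_imp_le[OF tilt_pos])
qed

lemma lr_measurable [measurable]: "lr \<sigma> h \<in> borel_measurable borel"
  unfolding lr_def by measurable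

section \<open>Moments of the likelihood ratio\<close>

definition moment :: "real \<Rightarrow> real \<Rightarrow> nat \<Rightarrow> real \<Rightarrow> real" where
  "moment \<sigma> h k \<beta> = (\<integral>y. normal_density 0 \<sigma> y * (lr \<sigma> h y ^ k * tilt \<sigma> (h * \<beta>) y) \<partial>lborel)"

text \<open>One factor \<open>lr\<close> is expanded and each of its tilts is merged with the tilt
  by \<open>h * \<beta>\<close>. Stated for the integrand, the recursion yields integrability as
  well as the value of the moments.\<close>

lemma lr_power_Suc:
  "normal_density 0 \<sigma> y * (lr \<sigma> h y ^ Suc k * tilt \<sigma> (h * \<beta>) y) =
    (\<Sum>c\<in>A. w c * exp (h\<^sup>2 / \<sigma>\<^sup>2 * (x c * \<beta>)) *
      (normal_density 0 \<sigma> y * (lr \<sigma> h y ^ k * tilt \<sigma> (h * (\<beta> + x c)) y)))"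
proof -
  have *: "tilt \<sigma> (h * x c) y * tilt \<sigma> (h * \<beta>) y =
      exp (h\<^sup>2 / \<sigma>\<^sup>2 * (x c * \<beta>)) * tilt \<sigma> (h * (\<beta> + x c)) y" for c
    by (simp add: tilt_mult algebra_simps power2_eq_square)
  have "lr \<sigma> h y * tilt \<sigma> (h * \<beta>) y =
      (\<Sum>c\<in>A. w c * exp (h\<^sup>2 / \<sigma>\<^sup>2 * (x c * \<beta>)) * tilt \<sigma> (h * (\<beta> + x c)) y)"
    by (simp add: lr_def sum_distrib_right mult.assoc *)
  then have "normal_density 0 \<sigma> y * (lr \<sigma> h y ^ Suc k * tilt \<sigma> (h * \<beta>) y) =
      normal_density 0 \<sigma> y * lr \<sigma> h y ^ k *
      (\<Sum>c\<in>A. w c * exp (h\<^sup>2 / \<sigma>\<^sup>2 * (x c * \<beta>)) * tilt \<sigma> (h * (\<beta> + x c)) y)"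
    by (simp add: mult_ac)
  then show ?thesis by (simp add: sum_distrib_left mult_ac)
qed

context
  fixes \<sigma> :: real
  assumes \<sigma>: "0 < \<sigma>"
begin

lemma integrable_moment:
  "integrable lborel (\<lambda>y. normal_density 0 \<sigma> y * (lr \<sigma> h y ^ k * tilt \<sigma> (h * \<beta>) y))"
proof (induction k arbitrary: \<beta>)
  case 0
  then show ?case using \<sigma> by (simp add: normal_density_tilt[symmetric])
next
  case (Suc k)
  then show ?case unfolding lr_power_Suc by (intro Bochner_Integration.integrable_sum integrable_mult_right)
qed

lemma moment_0 [simp]: "moment \<sigma> h 0 \<beta> = 1"
  using \<sigma> by (simp add: moment_def normal_density_tilt[symmetric])

lemma moment_Suc:
  "moment \<sigma> h (Suc k) \<beta> =
    (\<Sum>c\<in>A. w c * (exp (h\<^sup>2 / \<sigma>\<^sup>2 * (x c * \<beta>)) * moment \<sigma> h k (\<beta> + x c)))"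
  unfolding moment_def lr_power_Suc
  by (subst Bochner_Integration.integral_sum) (auto intro!: integrable_mult_right integrable_moment simp: mult.assoc)

text \<open>The additional tilt \<open>\<beta>\<close> and the factor \<open>exp (\<theta> s)\<close> make the statement inductive: integrating
  out one factor of the likelihood ratio moves \<open>(s, \<beta>)\<close> to \<open>(s + x c \<beta>, \<beta> + x c)\<close>.\<close>

lemma moment_approx_tilted:
  assumes "\<bar>s\<bar> + real k * B * \<bar>\<beta>\<bar> + real (k choose 2) * B\<^sup>2 \<le> S" and "h\<^sup>2 / \<sigma>\<^sup>2 * S \<le> 1"
  shows "\<bar>exp (h\<^sup>2 / \<sigma>\<^sup>2 * s) * moment \<sigma> h k \<beta> -
      (1 + h\<^sup>2 / \<sigma>\<^sup>2 * (s + real k * \<beta> * mean + real (k choose 2) * mean\<^sup>2))\<bar> \<le> (h\<^sup>2 / \<sigma>\<^sup>2 * S)\<^sup>2"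
  using assms(1)
proof (induction k arbitrary: s \<beta>)
  case 0
  define \<theta> where "\<theta> = h\<^sup>2 / \<sigma>\<^sup>2"
  have \<theta>: "0 \<le> \<theta>" by (simp add: \<theta>_def)
  have le: "\<bar>\<theta> * s\<bar> \<le> \<theta> * S" using 0 \<theta> by (auto simp: abs_mult binomial_eq_0 intro!: mult_left_mono)
  then have "\<bar>exp (\<theta> * s) - (1 + \<theta> * s)\<bar> \<le> (\<theta> * s)\<^sup>2"
    using assms(2) by (intro abs_exp_minus_linear_le) (simp add: \<theta>_def)
  also have "\<dots> \<le> (\<theta> * S)\<^sup>2" using le by (simp add: abs_le_square_iff[symmetric])
  finally show ?case by (simp add: \<theta>_def binomial_eq_0)
next
  case (Suc k)
  define \<theta> where "\<theta> = h\<^sup>2 / \<sigma>\<^sup>2"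
  define r where "r c = exp (\<theta> * (s + x c * \<beta>)) * moment \<sigma> h k (\<beta> + x c) -
      (1 + \<theta> * (s + x c * \<beta> + real k * (\<beta> + x c) * mean + real (k choose 2) * mean\<^sup>2))" for c
  have choose: "real (Suc k choose 2) = real k + real (k choose 2)"
    by (simp add: numeral_2_eq_2)
  have "\<bar>r c\<bar> \<le> (\<theta> * S)\<^sup>2" if c: "c \<in> A" for c
    unfolding r_def \<theta>_def
  proof (rule Suc.IH)
    \<comment> \<open>The budget \<open>S\<close> survives the step: the growth of \<open>s\<close>
      and \<open>\<beta>\<close> costs at most \<open>B * \<bar>\<beta>\<bar>\<close> and
      \<open>k * B\<^sup>2\<close>, exactly what dropping from \<open>Suc k\<close> to
      \<open>k\<close> factors releases.\<close>
    have "\<bar>s + x c * \<beta>\<bar> \<le> \<bar>s\<bar> + B * \<bar>\<beta>\<bar>"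
      using x_bound[OF c] mult_right_mono[of "\<bar>x c\<bar>" B "\<bar>\<beta>\<bar>"]
      by (intro order_trans[OF abs_triangle_ineq]) (simp add: abs_mult)
    moreover have "real k * B * \<bar>\<beta> + x c\<bar> \<le> real k * B * (\<bar>\<beta>\<bar> + B)"
      using x_bound[OF c] B_nonneg by (intro mult_left_mono) auto
    ultimately show "\<bar>s + x c * \<beta>\<bar> + real k * B * \<bar>\<beta> + x c\<bar> + real (k choose 2) * B\<^sup>2 \<le> S"
      using Suc.prems by (simp only: choose) (simp add: algebra_simps power2_eq_square)
  qed
  then have "\<bar>\<Sum>c\<in>A. w c * r c\<bar> \<le> (\<theta> * S)\<^sup>2" by (rule abs_average_le)
  moreover have "(\<Sum>c\<in>A. w c * r c) = exp (\<theta> * s) * moment \<sigma> h (Suc k) \<beta> -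
      (1 + \<theta> * (s + real (Suc k) * \<beta> * mean + real (Suc k choose 2) * mean\<^sup>2))"
  proof -
    have "(\<Sum>c\<in>A. w c * r c) =
        (\<Sum>c\<in>A. exp (\<theta> * s) * (w c * (exp (\<theta> * (x c * \<beta>)) * moment \<sigma> h k (\<beta> + x c)))
          - (w c * (1 + \<theta> * (s + real k * \<beta> * mean + real (k choose 2) * mean\<^sup>2))
             + \<theta> * (\<beta> + real k * mean) * (w c * x c)))"
      by (intro sum.cong) (simp_all add: r_def exp_add algebra_simps)
    also have "\<dots> = exp (\<theta> * s) * moment \<sigma> h (Suc k) \<beta> -
        ((1 + \<theta> * (s + real k * \<beta> * mean + real (k choose 2) * mean\<^sup>2))
          + \<theta> * (\<beta> + real k * mean) * mean)"
      by (simp add: sum_subtractf sum.distrib sum_distrib_left[symmetric] sum_distrib_right[symmetric]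
          sum_divide_distrib[symmetric] w_sum mean_def[symmetric] moment_Suc \<theta>_def)
    also have "\<dots> = exp (\<theta> * s) * moment \<sigma> h (Suc k) \<beta> -
      (1 + \<theta> * (s + real (Suc k) * \<beta> * mean + real (Suc k choose 2) * mean\<^sup>2))"
      unfolding choose by (simp add: algebra_simps power2_eq_square)
    finally show ?thesis .
  qed
  ultimately show ?case by (simp add: \<theta>_def)
qed

text \<open>The \<open>k\<close>-th moment is the average of exp(\<theta> P), where P is the sum of
  the products of all pairs among \<open>k\<close> independent symbols; each of the
  \<open>k choose 2\<close> pairs has expected product \<open>mean\<^sup>2\<close>.\<close>

lemma moment_approx:
  assumes "h\<^sup>2 / \<sigma>\<^sup>2 * (real (k choose 2) * B\<^sup>2) \<le> 1"
  shows "\<bar>moment \<sigma> h k 0 - (1 + real (k choose 2) * (h\<^sup>2 / \<sigma>\<^sup>2 * mean\<^sup>2))\<bar>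
    \<le> (real (k choose 2))\<^sup>2 * (h\<^sup>2 / \<sigma>\<^sup>2 * B\<^sup>2)\<^sup>2"
proof -
  have "(h\<^sup>2 / \<sigma>\<^sup>2 * (real (k choose 2) * B\<^sup>2))\<^sup>2 = (real (k choose 2))\<^sup>2 * (h\<^sup>2 / \<sigma>\<^sup>2 * B\<^sup>2)\<^sup>2"
    by (metis mult.left_commute power_mult_distrib)
  then show ?thesis
    using moment_approx_tilted[of 0 k 0 _ h, OF _ assms] by (simp add: mult.left_commute)
qed

lemma moment_1 [simp]: "moment \<sigma> h (Suc 0) 0 = 1"
  by (simp add: moment_Suc w_sum)

text \<open>The second moment averages exp(\<theta> x x') over two independent symbols. Unlike the
  expansion, this bound holds for every \<open>h\<close>.\<close>

lemma moment_2_le: "moment \<sigma> h 2 0 \<le> exp (h\<^sup>2 / \<sigma>\<^sup>2 * B\<^sup>2)"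
proof -
  have "moment \<sigma> h (Suc 0) b \<le> exp (h\<^sup>2 / \<sigma>\<^sup>2 * B\<^sup>2)" if "\<bar>b\<bar> \<le> B" for b
  proof -
    have "x c * b \<le> B\<^sup>2" if "c \<in> A" for c
      using mult_mono[OF x_bound[OF that] \<open>\<bar>b\<bar> \<le> B\<close>] B_nonneg
      by (simp add: power2_eq_square abs_mult[symmetric])
    then show ?thesis
      by (auto simp: moment_Suc intro!: average_le mult_left_mono divide_right_mono)
  qed
  then show ?thesis by (auto simp: numeral_2_eq_2 moment_Suc[of h "Suc 0"] x_bound intro!: average_le)
qed

section \<open>Relative entropy, in nats, of the output given \<open>H = h\<close> with respect to
  the noise\<close>

definition kl :: "real \<Rightarrow> real" where
  "kl h = (\<integral>y. normal_density 0 \<sigma> y * (lr \<sigma> h y * ln (lr \<sigma> h y)) \<partial>lborel)"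

lemma integrable_lr_power [simp]:
  "integrable lborel (\<lambda>y. normal_density 0 \<sigma> y * lr \<sigma> h y ^ k)"
  using integrable_moment[of h k 0] by simp

text \<open>From \<open>1 - 1 / F \<le> ln F \<le> F - 1\<close> the function
  \<open>F * ln F\<close> is dominated by \<open>F\<^sup>2 + 1\<close>, and the second moment is
  finite.\<close>

lemma integrable_kl [simp]:
  "integrable lborel (\<lambda>y. normal_density 0 \<sigma> y * (lr \<sigma> h y * ln (lr \<sigma> h y)))"
proof (rule Bochner_Integration.integrable_bound)
  show "integrable lborel (\<lambda>y. normal_density 0 \<sigma> y * lr \<sigma> h y ^ 2 + normal_density 0 \<sigma> y)"
    using \<sigma> by (intro Bochner_Integration.integrable_add) auto
  have *: "\<bar>F * ln F\<bar> \<le> F\<^sup>2 + 1" if F: "0 < F" for F :: real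
  proof -
    have "F * ln F \<le> F * (F - 1)" using F by (intro mult_left_mono ln_le_minus_one) auto
    moreover have "F * (1 - inverse F) \<le> F * ln F"
      using F ln_le_minus_one[of "inverse F"] by (intro mult_left_mono) (auto simp: ln_inverse)
    moreover have "F * (F - 1) \<le> F\<^sup>2 + 1" "- (F\<^sup>2 + 1) \<le> F * (1 - inverse F)"
      using F by (auto simp: algebra_simps power2_eq_square intro: order_trans[of _ 0])
    ultimately show ?thesis by (simp only: abs_le_iff) linarith
  qed
  show "AE y in lborel. norm (normal_density 0 \<sigma> y * (lr \<sigma> h y * ln (lr \<sigma> h y)))
      \<le> norm (normal_density 0 \<sigma> y * lr \<sigma> h y ^ 2 + normal_density 0 \<sigma> y)"
  proof (intro AE_I2)
    fix y
    have "\<bar>lr \<sigma> h y * ln (lr \<sigma> h y)\<bar> \<le> (lr \<sigma> h y)\<^sup>2 + 1"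
      using * lr_pos by blast
    then have "normal_density 0 \<sigma> y * \<bar>lr \<sigma> h y * ln (lr \<sigma> h y)\<bar> \<le>
        normal_density 0 \<sigma> y * ((lr \<sigma> h y)\<^sup>2 + 1)"
      by (rule mult_left_mono) simp
    then show "norm (normal_density 0 \<sigma> y * (lr \<sigma> h y * ln (lr \<sigma> h y)))
      \<le> norm (normal_density 0 \<sigma> y * lr \<sigma> h y ^ 2 + normal_density 0 \<sigma> y)"
      by (simp add: abs_mult distrib_left)
  qed
qed measurable

text \<open>The coefficients \<open>a1\<close> and \<open>a0\<close> stand alone because the moments
  of order 1 and 0 equal 1.\<close>

lemma integral_lr_polynomial:
  "has_bochner_integral lborel
    (\<lambda>y. normal_density 0 \<sigma> y * (a4 * lr \<sigma> h y ^ 4 + a3 * lr \<sigma> h y ^ 3 + a2 * (lr \<sigma> h y)\<^sup>2 + a1 * lr \<sigma> h y + a0))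
    (a4 * moment \<sigma> h 4 0 + a3 * moment \<sigma> h 3 0 + a2 * moment \<sigma> h 2 0 + a1 + a0)"
proof -
  have p: "has_bochner_integral lborel (\<lambda>y. normal_density 0 \<sigma> y * lr \<sigma> h y ^ k) (moment \<sigma> h k 0)" for k
    by (simp add: has_bochner_integral_iff) (simp add: moment_def)
  have "has_bochner_integral lborel
    (\<lambda>y. a4 * (normal_density 0 \<sigma> y * lr \<sigma> h y ^ 4) + a3 * (normal_density 0 \<sigma> y * lr \<sigma> h y ^ 3)
      + a2 * (normal_density 0 \<sigma> y * lr \<sigma> h y ^ 2) + a1 * (normal_density 0 \<sigma> y * lr \<sigma> h y ^ 1)
      + a0 * (normal_density 0 \<sigma> y * lr \<sigma> h y ^ 0))
    (a4 * moment \<sigma> h 4 0 + a3 * moment \<sigma> h 3 0 + a2 * moment \<sigma> h 2 0 + a1 * moment \<sigma> h 1 0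
      + a0 * moment \<sigma> h 0 0)"
    by (intro has_bochner_integral_add has_bochner_integral_mult_right p)
  then show ?thesis by (simp add: algebra_simps)
qed

lemma kl_ge_polynomial:
  assumes "\<And>F. 0 < F \<Longrightarrow> a4 * F ^ 4 + a3 * F ^ 3 + a2 * F\<^sup>2 + a1 * F + a0 \<le> F * ln F"
  shows "a4 * moment \<sigma> h 4 0 + a3 * moment \<sigma> h 3 0 + a2 * moment \<sigma> h 2 0 + a1 + a0 \<le> kl h"
proof -
  note P = integral_lr_polynomial[of a4 h a3 a2 a1 a0, unfolded has_bochner_integral_iff]
  show ?thesis
    unfolding kl_def P[THEN conjunct2, symmetric] using P assms lr_pos
    by (intro integral_mono mult_left_mono) auto
qed

lemma kl_le_polynomial:
  assumes "\<And>F. 0 < F \<Longrightarrow> F * ln F \<le> a4 * F ^ 4 + a3 * F ^ 3 + a2 * F\<^sup>2 + a1 * F + a0"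
  shows "kl h \<le> a4 * moment \<sigma> h 4 0 + a3 * moment \<sigma> h 3 0 + a2 * moment \<sigma> h 2 0 + a1 + a0"
proof -
  note P = integral_lr_polynomial[of a4 h a3 a2 a1 a0, unfolded has_bochner_integral_iff]
  show ?thesis
    unfolding kl_def P[THEN conjunct2, symmetric] using P assms lr_pos
    by (intro integral_mono mult_left_mono) auto
qed

lemma kl_nonneg: "0 \<le> kl h"
proof -
  have "F - 1 \<le> F * ln F" if F: "0 < F" for F :: real
  proof -
    have "F * (1 - inverse F) \<le> F * ln F"
      using F ln_le_minus_one[of "inverse F"] by (intro mult_left_mono) (auto simp: ln_inverse)
    then show ?thesis using F by (simp add: algebra_simps)
  qed
  then show ?thesis using kl_ge_polynomial[of 0 0 0 1 "-1" h] by simp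
qed

lemma kl_le: "kl h \<le> h\<^sup>2 / \<sigma>\<^sup>2 * B\<^sup>2"
proof -
  define T where "T = h\<^sup>2 / \<sigma>\<^sup>2 * B\<^sup>2"
  \<comment> \<open>Jensen's inequality \<open>\<integral> \<phi> F ln F \<le> ln (\<integral> \<phi> F\<^sup>2)\<close>, through the tangent of \<open>ln\<close> at \<open>exp T\<close>.\<close>
  have "F * ln F \<le> exp (- T) * F\<^sup>2 + (T - 1) * F" if F: "0 < F" for F :: real
  proof -
    have "ln F = ln (F * exp (- T)) + T" using F by (simp add: ln_mult)
    also have "\<dots> \<le> F * exp (- T) - 1 + T" using F by (intro add_mono ln_le_minus_one) auto
    finally have "F * ln F \<le> F * (F * exp (- T) - 1 + T)" using F by (intro mult_left_mono) auto
    then show ?thesis by (simp add: algebra_simps power2_eq_square)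
  qed
  then have "kl h \<le> exp (- T) * moment \<sigma> h 2 0 + (T - 1)"
    using kl_le_polynomial[of 0 0 "exp (- T)" "T - 1" 0 h] by simp
  also have "exp (- T) * moment \<sigma> h 2 0 \<le> exp (- T) * exp T"
    unfolding T_def by (intro mult_left_mono moment_2_le) auto
  also have "\<dots> = 1" by (simp add: exp_minus)
  finally show ?thesis by (simp add: T_def)
qed

lemma kl_approx: "\<bar>kl h - h\<^sup>2 / \<sigma>\<^sup>2 * mean\<^sup>2 / 2\<bar> \<le> 29 * (h\<^sup>2 / \<sigma>\<^sup>2 * B\<^sup>2)\<^sup>2"
proof -
  define T where "T = h\<^sup>2 / \<sigma>\<^sup>2 * B\<^sup>2"
  define p where "p = h\<^sup>2 / \<sigma>\<^sup>2 * mean\<^sup>2"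
  have p: "0 \<le> p" "p \<le> T"
    using abs_mean_le by (auto simp: p_def T_def abs_le_square_iff[symmetric] B_nonneg intro!: mult_left_mono divide_right_mono)
  have choose: "(2::nat) choose 2 = 1" "(3::nat) choose 2 = 3" "(4::nat) choose 2 = 6"
    by (simp_all add: eval_nat_numeral)
  \<comment> \<open>The threshold is \<open>4 choose 2 = 6\<close>: below it the moment expansion is
    available for every order up to 4.\<close>
  show ?thesis
  proof (cases "6 * T \<le> 1")
    case True
    have m2: "\<bar>moment \<sigma> h 2 0 - (1 + p)\<bar> \<le> T\<^sup>2"
      using moment_approx[of h 2] True p by (simp add: p_def T_def choose mult.left_commute)
    have m3: "\<bar>moment \<sigma> h 3 0 - (1 + 3 * p)\<bar> \<le> 9 * T\<^sup>2"
      using moment_approx[of h 3] True p by (simp add: p_def T_def choose mult.left_commute)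
    have m4: "\<bar>moment \<sigma> h 4 0 - (1 + 6 * p)\<bar> \<le> 36 * T\<^sup>2"
      using moment_approx[of h 4] True p by (simp add: p_def T_def choose mult.left_commute)
    have "(-1/6) * moment \<sigma> h 3 0 + moment \<sigma> h 2 0 - 1/2 - 1/3 \<le> kl h"
    proof -
      have "(-1/6) * F ^ 3 + F\<^sup>2 - F / 2 - 1/3 \<le> F * ln F" if "0 < F" for F :: real
        using mult_ln_ge_cubic[of "F - 1"] that
        by (simp add: field_simps power2_eq_square power3_eq_cube)
      then show ?thesis using kl_ge_polynomial[of 0 "-1/6" 1 "-1/2" "-1/3" h] by simp
    qed
    moreover have "kl h \<le> 1/3 * moment \<sigma> h 4 0 - 3/2 * moment \<sigma> h 3 0 + 3 * moment \<sigma> h 2 0 - 11/6"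
    proof -
      have "F * ln F \<le> 1/3 * F ^ 4 - 3/2 * F ^ 3 + 3 * F\<^sup>2 - 11/6 * F" if "0 < F" for F :: real
        using mult_ln_le_quartic[of "F - 1"] that
        by (simp add: field_simps power2_eq_square power3_eq_cube power4_eq_xxxx)
      then show ?thesis using kl_le_polynomial[of "1/3" "-3/2" 3 "-11/6" 0 h] by simp
    qed
    \<comment> \<open>The constant and linear terms of both bounds agree with \<open>p / 2\<close>.
      The moment errors add up to 36/3 + 9 * 3/2 + 3 = 28.5 times \<open>T\<^sup>2\<close> above and
      9/6 + 1 = 2.5 times below.\<close>
    ultimately have "\<bar>kl h - p / 2\<bar> \<le> 29 * T\<^sup>2"
      using m2 m3 m4 zero_le_power2[of T] unfolding abs_le_iff by linarith
    then show ?thesis by (simp add: p_def T_def)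
  next
    case False
    \<comment> \<open>Outside the range of the expansion both \<open>kl h\<close> and
      \<open>p / 2\<close> lie between 0 and \<open>T\<close>, and \<open>T > 1/6\<close> makes
      \<open>T\<close> smaller than \<open>6 * T\<^sup>2\<close>.\<close>
    have "\<bar>kl h - p / 2\<bar> \<le> T"
      using kl_nonneg[of h] kl_le[of h, folded T_def] p unfolding abs_le_iff by linarith
    also have "T \<le> 29 * T\<^sup>2" using False by (simp add: power2_eq_square)
    finally show ?thesis by (simp add: p_def T_def)
  qed
qed

end

end

section \<open>Averaging over the fading channel\<close>

text \<open>Every exponent in the mixture has absolute value at most K, the right-hand side, so the
  average lies between exp(-K) and exp(K). The quadratic growth in \<open>h\<close> and
  \<open>y\<close> is what makes the log-likelihood ratios integrable.\<close>

lemma (in finite_mixture) abs_ln_lr_le: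
  assumes \<sigma>: "0 < \<sigma>"
  shows "\<bar>ln (lr \<sigma> h y)\<bar> \<le> (B\<^sup>2 * h\<^sup>2 + y\<^sup>2) / \<sigma>\<^sup>2"
proof -
  define K where "K = (B\<^sup>2 * h\<^sup>2 + y\<^sup>2) / \<sigma>\<^sup>2"
  have K: "\<bar>(h * x c * y - (h * x c)\<^sup>2 / 2) / \<sigma>\<^sup>2\<bar> \<le> K" if c: "c \<in> A" for c
  proof -
    have "\<bar>h * x c\<bar> \<le> \<bar>h * B\<bar>"
      using x_bound[OF c] by (simp add: abs_mult mult_left_mono)
    then have sq: "(h * x c)\<^sup>2 \<le> (h * B)\<^sup>2" by (simp only: abs_le_square_iff)
    have "0 \<le> (h * x c - y)\<^sup>2" "0 \<le> (h * x c + y)\<^sup>2" "0 \<le> y\<^sup>2" "0 \<le> (h * x c)\<^sup>2"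
      by simp_all
    then have "\<bar>h * x c * y - (h * x c)\<^sup>2 / 2\<bar> \<le> (h * B)\<^sup>2 + y\<^sup>2"
      using sq unfolding abs_le_iff power2_sum power2_diff by linarith
    then have "\<bar>h * x c * y - (h * x c)\<^sup>2 / 2\<bar> / \<sigma>\<^sup>2 \<le> ((h * B)\<^sup>2 + y\<^sup>2) / \<sigma>\<^sup>2"
      by (rule divide_right_mono) simp
    then show ?thesis by (simp add: K_def abs_divide power_mult_distrib mult.commute)
  qed
  have "exp (- K) \<le> lr \<sigma> h y"
    unfolding lr_def tilt_def by (intro average_ge) (use K in \<open>force simp only: abs_le_iff exp_le_cancel_iff\<close>)
  moreover have "lr \<sigma> h y \<le> exp K"
    unfolding lr_def tilt_def by (intro average_le) (use K in \<open>force simp only: abs_le_iff exp_le_cancel_iff\<close>)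
  ultimately have "- K \<le> ln (lr \<sigma> h y)" "ln (lr \<sigma> h y) \<le> K"
    using lr_pos[of \<sigma> h y] by (simp_all add: ln_ge_iff ln_le_cancel_iff[of _ "exp K", simplified])
  then show ?thesis by (simp add: K_def abs_le_iff)
qed

section \<open>Channel integrals in terms of uniform mixtures\<close>

lemma finite_mixture_uniform:
  assumes "finite A" "A \<noteq> {}" "\<And>c. c \<in> A \<Longrightarrow> \<bar>x c\<bar> \<le> B"
  shows "finite_mixture A (\<lambda>_. 1 / real (card A)) x B"
proof
  obtain c where "c \<in> A" using assms by auto
  then show "0 \<le> B" using assms(3)[of c] by linarith
qed (use assms in auto)

lemma cond_pmf_of_set:
  assumes "finite A" "A \<inter> S \<noteq> {}"
  shows "cond_pmf (pmf_of_set A) S = pmf_of_set (A \<inter> S)"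
proof (rule pmf_eqI)
  fix c
  have A: "A \<noteq> {}" using assms by auto
  moreover have "set_pmf (pmf_of_set A) \<inter> S \<noteq> {}" using assms A by (simp add: set_pmf_of_set)
  ultimately show "pmf (cond_pmf (pmf_of_set A) S) c = pmf (pmf_of_set (A \<inter> S)) c"
    using assms by (auto simp: pmf_cond measure_pmf_of_set split: split_indicator)
qed

lemma output_density_pmf_of_set:
  assumes A: "finite A" "A \<noteq> {}" "\<And>c. c \<in> A \<Longrightarrow> \<bar>symbol xs L c\<bar> \<le> B" and N0: "0 < N0"
  shows "output_density (pmf_of_set A) xs L N0 h y = normal_density 0 (sqrt (N0 / 2)) y *
    finite_mixture.lr A (\<lambda>_. 1 / real (card A)) (symbol xs L) (sqrt (N0 / 2)) h y"
proof -
  interpret finite_mixture A "\<lambda>_. 1 / real (card A)" "symbol xs L" B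
    by (rule finite_mixture_uniform) (use A in auto)
  show ?thesis
    using A N0
    by (simp add: output_density_def integral_pmf_of_set lr_def normal_density_tilt[of "sqrt (N0 / 2)" "h * _"]
        sum_divide_distrib sum_distrib_left)
qed

text \<open>Fubini over bits, fading and noise, followed by the substitution
  \<open>y = h * s c + z\<close>. The quadratic bound reduces integrability to the second moments of
  fading and noise.\<close>

lemma has_bochner_integral_channel:
  fixes f :: "bool list \<Rightarrow> real \<Rightarrow> real \<Rightarrow> real"
  assumes \<nu>: "real_distribution \<nu>" and N0: "0 < N0" and h2: "integrable \<nu> (\<lambda>h. h\<^sup>2)"
    and meas [measurable]: "\<And>c. (\<lambda>(h, y). f c h y) \<in> borel_measurable (borel \<Otimes>\<^sub>M borel)"
    and bound: "\<And>c h y. length c = m \<Longrightarrow> \<bar>f c h y\<bar> \<le> K * (h\<^sup>2 + y\<^sup>2)"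
  shows "has_bochner_integral \<nu>
    (\<lambda>h. \<integral>y. (\<Sum>c | length c = m. normal_density (h * s c) (sqrt (N0 / 2)) y * f c h y) / 2 ^ m \<partial>lborel)
    (\<integral>(c, h, z). f c h (h * s c + z) \<partial>channel m \<nu> N0)"
proof -
  interpret \<nu>: real_distribution \<nu> by (rule \<nu>)
  define \<sigma> where "\<sigma> = sqrt (N0 / 2)"
  have \<sigma>: "0 < \<sigma>" using N0 by (simp add: \<sigma>_def)
  define g where "g = density lborel (normal_density 0 \<sigma>)"
  interpret g: prob_space g unfolding g_def using \<sigma> by (rule prob_space_normal_density)
  interpret gs: pair_prob_space \<nu> g ..
  interpret ch: pair_prob_space "measure_pmf (bits_pmf m)" "\<nu> \<Otimes>\<^sub>M g" ..
  have [measurable_cong, simp]: "sets g = sets borel" by (simp add: g_def)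
  have K: "0 \<le> K" using bound[of "replicate m False" 1 0] abs_ge_zero[of "f (replicate m False) 1 0"] by simp
  define F where "F c w = f c (fst w) (fst w * s c + snd w)" for c :: "bool list" and w :: "real \<times> real"
  have F_meas [measurable]: "F c \<in> borel_measurable (borel \<Otimes>\<^sub>M borel)" for c
  proof -
    have "(\<lambda>w. (fst w, fst w * s c + snd w)) \<in> (borel \<Otimes>\<^sub>M borel) \<rightarrow>\<^sub>M ((borel :: real measure) \<Otimes>\<^sub>M (borel :: real measure))"
      by measurable
    from measurable_compose[OF this meas[of c]] show ?thesis by (simp add: F_def[abs_def] case_prod_unfold)
  qed
  have sets_ch: "sets (measure_pmf (bits_pmf m) \<Otimes>\<^sub>M (\<nu> \<Otimes>\<^sub>M g)) =
      sets (count_space UNIV \<Otimes>\<^sub>M ((borel :: real measure) \<Otimes>\<^sub>M (borel :: real measure)))"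
    by (intro sets_pair_measure_cong) auto
  \<comment> \<open>Bit vectors form a countable discrete space, so measurability for each fixed
    \<open>c\<close> gives joint measurability.\<close>
  have F_joint: "case_prod F \<in> borel_measurable (measure_pmf (bits_pmf m) \<Otimes>\<^sub>M (\<nu> \<Otimes>\<^sub>M g))"
    unfolding measurable_cong_sets[OF sets_ch refl] case_prod_unfold
    by (rule measurable_compose_countable'[where I = UNIV and g = fst and f = "\<lambda>c w. F c (snd w)"]) auto
  have z2: "integrable g (\<lambda>z. z\<^sup>2)"
    using \<sigma> integrable_normal_moment[of \<sigma> 0 2] by (simp add: g_def integrable_real_density)
  have dom: "integrable (\<nu> \<Otimes>\<^sub>M g) (\<lambda>w. a * (fst w)\<^sup>2 + b * (snd w)\<^sup>2)" if "0 \<le> a" "0 \<le> b" for a b :: real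
  proof (rule gs.Fubini_integrable)
    have "(\<integral>z. norm (a * (fst (h, z))\<^sup>2 + b * (snd (h, z))\<^sup>2) \<partial>g) = a * h\<^sup>2 + b * (\<integral>z. z\<^sup>2 \<partial>g)" for h
      using that z2 by (simp add: g.prob_space)
    then show "integrable \<nu> (\<lambda>h. \<integral>z. norm (a * (fst (h, z))\<^sup>2 + b * (snd (h, z))\<^sup>2) \<partial>g)"
      using h2 by simp
  qed (use z2 in auto)
  have sq_add: "(u + v)\<^sup>2 \<le> 2 * u\<^sup>2 + 2 * v\<^sup>2" for u v :: real
    using sum_squares_bound[of u v] by (simp add: power2_sum)
  have F_int: "integrable (\<nu> \<Otimes>\<^sub>M g) (F c)" if c: "length c = m" for c
  proof (rule Bochner_Integration.integrable_bound)
    show "integrable (\<nu> \<Otimes>\<^sub>M g) (\<lambda>w. (K * (1 + 2 * (s c)\<^sup>2)) * (fst w)\<^sup>2 + (2 * K) * (snd w)\<^sup>2)"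
      using K by (intro dom) auto
    show "AE w in \<nu> \<Otimes>\<^sub>M g. norm (F c w) \<le> norm ((K * (1 + 2 * (s c)\<^sup>2)) * (fst w)\<^sup>2 + (2 * K) * (snd w)\<^sup>2)"
    proof (rule AE_I2)
      fix w :: "real \<times> real"
      have "\<bar>F c w\<bar> \<le> K * ((fst w)\<^sup>2 + (fst w * s c + snd w)\<^sup>2)"
        using bound[OF c] by (simp add: F_def)
      also have "\<dots> \<le> K * ((fst w)\<^sup>2 + (2 * (fst w * s c)\<^sup>2 + 2 * (snd w)\<^sup>2))"
        by (intro mult_left_mono add_left_mono sq_add K)
      also have "\<dots> = (K * (1 + 2 * (s c)\<^sup>2)) * (fst w)\<^sup>2 + (2 * K) * (snd w)\<^sup>2"
        by (simp add: algebra_simps power_mult_distrib)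
      finally show "norm (F c w) \<le> norm ((K * (1 + 2 * (s c)\<^sup>2)) * (fst w)\<^sup>2 + (2 * K) * (snd w)\<^sup>2)"
        by simp
    qed
  qed measurable
  have shift: "(\<integral>z. F c (h, z) \<partial>g) = (\<integral>y. normal_density (h * s c) \<sigma> y * f c h y \<partial>lborel)" for c h
  proof -
    have [measurable]: "f c h \<in> borel_measurable borel"
      using measurable_compose[OF measurable_Pair1'[of h borel borel] meas[of c]] by simp
    have "(\<integral>z. F c (h, z) \<partial>g) = (\<integral>z. normal_density 0 \<sigma> z * f c h (h * s c + z) \<partial>lborel)"
      unfolding g_def F_def by (subst integral_real_density) auto
    also have "\<dots> = (\<integral>z. normal_density (h * s c) \<sigma> (h * s c + 1 * z) * f c h (h * s c + 1 * z) \<partial>lborel)"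
      by (simp add: normal_density_def)
    also have "\<dots> = (\<integral>y. normal_density (h * s c) \<sigma> y * f c h y \<partial>lborel)"
      by (subst lborel_integral_real_affine[of 1 _ "h * s c"]) auto
    finally show ?thesis .
  qed
  \<comment> \<open>Fubini would give this only for almost every \<open>h\<close>; the final
    exchange of sum and integral over \<open>y\<close> is made for every \<open>h\<close>.\<close>
  have y_int: "integrable lborel (\<lambda>y. normal_density (h * s c) \<sigma> y * f c h y)" if c: "length c = m" for c h
  proof (rule Bochner_Integration.integrable_bound)
    have [measurable]: "f c h \<in> borel_measurable borel"
      using measurable_compose[OF measurable_Pair1'[of h borel borel] meas[of c]] by simp
    show "(\<lambda>y. normal_density (h * s c) \<sigma> y * f c h y) \<in> borel_measurable lborel" by measurable
    show "integrable lborel (\<lambda>y. (K * (h\<^sup>2 + 2 * (h * s c)\<^sup>2)) * normal_density (h * s c) \<sigma> y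
        + (2 * K) * (normal_density (h * s c) \<sigma> y * (y - h * s c)\<^sup>2))"
      using \<sigma> by (intro Bochner_Integration.integrable_add integrable_mult_right integrable_normal_moment
          integrable_normal_density)
    show "AE y in lborel. norm (normal_density (h * s c) \<sigma> y * f c h y) \<le>
        norm ((K * (h\<^sup>2 + 2 * (h * s c)\<^sup>2)) * normal_density (h * s c) \<sigma> y
        + (2 * K) * (normal_density (h * s c) \<sigma> y * (y - h * s c)\<^sup>2))"
    proof (rule AE_I2)
      fix y
      have "\<bar>f c h y\<bar> \<le> K * (h\<^sup>2 + (h * s c + (y - h * s c))\<^sup>2)" using bound[OF c, of h y] by simp
      also have "\<dots> \<le> K * (h\<^sup>2 + (2 * (h * s c)\<^sup>2 + 2 * (y - h * s c)\<^sup>2))"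
        by (intro mult_left_mono add_left_mono sq_add K)
      finally have "normal_density (h * s c) \<sigma> y * \<bar>f c h y\<bar> \<le>
          normal_density (h * s c) \<sigma> y * (K * (h\<^sup>2 + (2 * (h * s c)\<^sup>2 + 2 * (y - h * s c)\<^sup>2)))"
        by (rule mult_left_mono) simp
      also have "\<dots> = (K * (h\<^sup>2 + 2 * (h * s c)\<^sup>2)) * normal_density (h * s c) \<sigma> y
          + (2 * K) * (normal_density (h * s c) \<sigma> y * (y - h * s c)\<^sup>2)"
        by (simp add: algebra_simps)
      finally show "norm (normal_density (h * s c) \<sigma> y * f c h y) \<le>
        norm ((K * (h\<^sup>2 + 2 * (h * s c)\<^sup>2)) * normal_density (h * s c) \<sigma> y
        + (2 * K) * (normal_density (h * s c) \<sigma> y * (y - h * s c)\<^sup>2))"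
        by (simp add: abs_mult)
    qed
  qed
  define I where "I c h = (\<integral>y. normal_density (h * s c) \<sigma> y * f c h y \<partial>lborel)" for c h
  have F_has: "has_bochner_integral \<nu> (I c) (\<integral>w. F c w \<partial>(\<nu> \<Otimes>\<^sub>M g))" if "length c = m" for c
    using gs.integrable_fst'[OF F_int[OF that]] gs.integral_fst'[OF F_int[OF that]]
    by (simp add: has_bochner_integral_iff shift I_def[abs_def])
  have "integrable (measure_pmf (bits_pmf m) \<Otimes>\<^sub>M (\<nu> \<Otimes>\<^sub>M g)) (case_prod F)"
    by (rule ch.Fubini_integrable)
      (auto intro!: F_joint integrable_measure_pmf_finite AE_pmfI F_int simp: set_bits_pmf)
  then have "(\<integral>w. case_prod F w \<partial>(measure_pmf (bits_pmf m) \<Otimes>\<^sub>M (\<nu> \<Otimes>\<^sub>M g))) =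
      measure_pmf.expectation (bits_pmf m) (\<lambda>c. \<integral>w. F c w \<partial>(\<nu> \<Otimes>\<^sub>M g))"
    by (subst ch.integral_fst'[symmetric]) simp_all
  also have "\<dots> = (\<Sum>c | length c = m. \<integral>w. F c w \<partial>(\<nu> \<Otimes>\<^sub>M g)) / 2 ^ m"
    unfolding bits_pmf_def using Ex_list_of_length[of m]
    by (subst integral_pmf_of_set) (auto simp: card_bit_vectors)
  finally have lhs: "(\<integral>(c, h, z). f c h (h * s c + z) \<partial>channel m \<nu> N0) =
      (\<Sum>c | length c = m. \<integral>w. F c w \<partial>(\<nu> \<Otimes>\<^sub>M g)) / 2 ^ m"
    by (simp add: channel_def g_def \<sigma>_def F_def case_prod_unfold)
  have "has_bochner_integral \<nu> (\<lambda>h. (\<Sum>c | length c = m. I c h) / 2 ^ m)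
      ((\<Sum>c | length c = m. \<integral>w. F c w \<partial>(\<nu> \<Otimes>\<^sub>M g)) / 2 ^ m)"
    using F_has by (intro has_bochner_integral_divide_zero has_bochner_integral_sum) auto
  moreover have "(\<Sum>c | length c = m. I c h) / 2 ^ m =
      (\<integral>y. (\<Sum>c | length c = m. normal_density (h * s c) \<sigma> y * f c h y) / 2 ^ m \<partial>lborel)" for h
    using y_int by (simp add: I_def Bochner_Integration.integral_sum)
  ultimately show ?thesis by (simp add: lhs \<sigma>_def)
qed


text \<open>Flipping bit \<open>k\<close> is an involution that exchanges the two halves of the set
  of bit vectors.\<close>

lemma card_bit_vectors_nth:
  assumes "k < m"
  shows "card {c :: bool list. length c = m \<and> c ! k = u} = 2 ^ (m - 1)"
proof -
  define flip where "flip c = c[k := \<not> c ! k]" for c :: "bool list"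
  have "bij_betw flip {c. length c = m \<and> c ! k = u} {c. length c = m \<and> c ! k = (\<not> u)}"
    by (rule bij_betw_byWitness[where f' = flip]) (use assms in \<open>auto simp: flip_def list_update_same_conv\<close>)
  then have eq: "card {c. length c = m \<and> c ! k = u} = card {c. length c = m \<and> c ! k = (\<not> u)}"
    by (rule bij_betw_same_card)
  have "{c. length c = m} = {c. length c = m \<and> c ! k = u} \<union> {c. length c = m \<and> c ! k = (\<not> u)}"
    by auto
  then have "card {c :: bool list. length c = m} =
      card ({c. length c = m \<and> c ! k = u} \<union> {c. length c = m \<and> c ! k = (\<not> u)})"
    by (rule arg_cong)
  also have "\<dots> = card {c. length c = m \<and> c ! k = u} + card {c. length c = m \<and> c ! k = (\<not> u)}"
    by (rule card_Un_disjoint) (auto intro: finite_subset[OF _ finite_bit_vectors[of m]])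
  finally have "2 ^ m = 2 * card {c. length c = m \<and> c ! k = u}"
    using eq card_bit_vectors[of m] by simp
  moreover have "(2::nat) ^ m = 2 * 2 ^ (m - 1)"
    using assms by (metis gr_implies_not_zero power_eq_if)
  ultimately show ?thesis by simp
qed

section \<open>Contribution of a single bit to the capacity\<close>

definition average :: "'a set \<Rightarrow> ('a \<Rightarrow> real) \<Rightarrow> real" where
  "average A x = (\<Sum>c\<in>A. x c) / real (card A)"

text \<open>Given \<open>h\<close>, the term is the mean of the relative entropies of the two
  conditional laws minus that of the unconditioned law. Expanding all three leaves an error
  proportional to \<open>h ^ 4\<close>, which is integrated over \<open>\<nu>\<close>.\<close>

lemma bicm_term_approx:
  fixes m :: nat and xs :: "real list" and L :: bit_matrix
  assumes \<nu>: "real_distribution \<nu>" and N0: "0 < N0" and h4: "integrable \<nu> (\<lambda>h. h ^ 4)"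
    and B: "\<And>c. length c = m \<Longrightarrow> \<bar>symbol xs L c\<bar> \<le> B" and k: "k < m"
  defines "D \<equiv> ((average {c. length c = m \<and> c ! k} (symbol xs L))\<^sup>2
      + (average {c. length c = m \<and> \<not> c ! k} (symbol xs L))\<^sup>2) / 2
      - (average {c. length c = m} (symbol xs L))\<^sup>2"
  shows "\<bar>(\<integral>(c, h, z).
        (let y = h * symbol xs L c + z
         in log 2 (density_given_bit_H m xs L N0 k (c ! k) h y / density_given_H m xs L N0 h y))
        \<partial>channel m \<nu> N0) - (\<integral>h. h\<^sup>2 \<partial>\<nu>) * D / (N0 * ln 2)\<bar>
    \<le> 232 * B ^ 4 * (\<integral>h. h ^ 4 \<partial>\<nu>) / (N0\<^sup>2 * ln 2)"
proof -
  interpret \<nu>: real_distribution \<nu> by (rule \<nu>)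
  define \<sigma> where "\<sigma> = sqrt (N0 / 2)"
  have \<sigma>: "0 < \<sigma>" and \<sigma>2: "\<sigma>\<^sup>2 = N0 / 2" using N0 by (simp_all add: \<sigma>_def)
  have h2: "integrable \<nu> (\<lambda>h. h\<^sup>2)"
  proof (rule Bochner_Integration.integrable_bound)
    show "integrable \<nu> (\<lambda>h. h ^ 4 + 1)" using h4 by simp
    have "h\<^sup>2 \<le> h ^ 4 + 1" for h :: real
    proof -
      have "2 * h\<^sup>2 \<le> h ^ 4 + 1" using sum_squares_bound[of "h\<^sup>2" 1] by (simp flip: power_mult)
      then show ?thesis using zero_le_power2[of h] by linarith
    qed
    then show "AE h in \<nu>. norm (h\<^sup>2) \<le> norm (h ^ 4 + 1)" by simp
  qed simp
  define s where "s = symbol xs L"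
  define A where "A = {c :: bool list. length c = m}"
  define Au where "Au u = {c :: bool list. length c = m \<and> c ! k = u}" for u
  have fin: "finite A" "finite (Au u)" for u
    by (auto simp: A_def Au_def intro: finite_subset[OF _ finite_bit_vectors[of m]])
  have cardA: "card A = 2 ^ m" and cardAu: "card (Au u) = 2 ^ (m - 1)" for u
    using k by (simp_all add: A_def Au_def card_bit_vectors card_bit_vectors_nth)
  have ne: "A \<noteq> {}" "Au u \<noteq> {}" for u
    using cardA cardAu[of u] by (metis card.empty power_not_zero zero_neq_numeral)+
  interpret T: finite_mixture A "\<lambda>_. 1 / real (card A)" s B
    using fin ne B by (intro finite_mixture_uniform) (auto simp: A_def s_def)
  interpret U: finite_mixture "Au u" "\<lambda>_. 1 / real (card (Au u))" s B for u
    using fin ne B by (intro finite_mixture_uniform) (auto simp: Au_def s_def)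
  define \<phi> where "\<phi> = normal_density 0 \<sigma>"
  have \<phi>: "0 < \<phi> y" for y using \<sigma> by (simp add: \<phi>_def normal_density_pos)
  have den: "density_given_H m xs L N0 h y = \<phi> y * T.lr \<sigma> h y" for h y
    using output_density_pmf_of_set[of A xs L B N0 h y] fin ne B N0
    by (simp add: density_given_H_def bits_pmf_def A_def s_def \<phi>_def \<sigma>_def)
  have cond: "cond_pmf (bits_pmf m) {c. c ! k = u} = pmf_of_set (Au u)" for u
    using cond_pmf_of_set[of A "{c. c ! k = u}"] fin ne
    by (simp add: bits_pmf_def A_def Au_def Int_def)
  have denu: "density_given_bit_H m xs L N0 k u h y = \<phi> y * U.lr u \<sigma> h y" for u h y
    using output_density_pmf_of_set[of "Au u" xs L B N0 h y] fin ne B N0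
    by (simp add: density_given_bit_H_def cond s_def \<phi>_def \<sigma>_def Au_def)
  define f where "f c h y = (ln (U.lr (c ! k) \<sigma> h y) - ln (T.lr \<sigma> h y)) / ln 2" for c h y
  have log_eq: "log 2 (density_given_bit_H m xs L N0 k (c ! k) h y / density_given_H m xs L N0 h y) = f c h y"
    for c h y
    using \<phi>[of y] U.lr_pos[of "c ! k" \<sigma> h y] T.lr_pos[of \<sigma> h y]
    by (simp add: den denu f_def log_def ln_div)
  have meas: "(\<lambda>(h, y). f c h y) \<in> borel_measurable (borel \<Otimes>\<^sub>M borel)" for c
    unfolding f_def U.lr_def T.lr_def tilt_def by measurable
  have bound: "\<bar>f c h y\<bar> \<le> 2 * (B\<^sup>2 + 1) / (\<sigma>\<^sup>2 * ln 2) * (h\<^sup>2 + y\<^sup>2)" for c h y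
  proof -
    have "\<bar>ln (U.lr (c ! k) \<sigma> h y) - ln (T.lr \<sigma> h y)\<bar> \<le> 2 * ((B\<^sup>2 * h\<^sup>2 + y\<^sup>2) / \<sigma>\<^sup>2)"
      using U.abs_ln_lr_le[OF \<sigma>, of "c ! k" h y] T.abs_ln_lr_le[OF \<sigma>, of h y] by linarith
    also have "\<dots> \<le> 2 * (((B\<^sup>2 + 1) * (h\<^sup>2 + y\<^sup>2)) / \<sigma>\<^sup>2)"
      by (intro mult_left_mono divide_right_mono) (auto simp: algebra_simps)
    finally have "\<bar>ln (U.lr (c ! k) \<sigma> h y) - ln (T.lr \<sigma> h y)\<bar> / ln 2 \<le>
        2 * (((B\<^sup>2 + 1) * (h\<^sup>2 + y\<^sup>2)) / \<sigma>\<^sup>2) / ln 2"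
      by (rule divide_right_mono) simp
    then show ?thesis by (simp add: f_def abs_divide mult.assoc del: distrib_left_numeral)
  qed
  define J where "J h = ((U.kl True \<sigma> h + U.kl False \<sigma> h) / 2 - T.kl \<sigma> h) / ln 2" for h
  have inner: "(\<integral>y. (\<Sum>c | length c = m. normal_density (h * s c) \<sigma> y * f c h y) / 2 ^ m \<partial>lborel) = J h" for h
  proof -
    have sumA: "(\<Sum>c\<in>A. normal_density (h * s c) \<sigma> y) = 2 ^ m * (\<phi> y * T.lr \<sigma> h y)" for y
      unfolding T.lr_def unfolding cardA normal_density_tilt[OF \<sigma>, of "h * _"] \<phi>_def
      by (simp add: sum_distrib_left)
    have sumU: "(\<Sum>c\<in>Au u. normal_density (h * s c) \<sigma> y) = 2 ^ m / 2 * (\<phi> y * U.lr u \<sigma> h y)" for u y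
    proof -
      have "(2::real) ^ m / 2 = 2 ^ (m - 1)" using k by (simp add: power_diff)
      then show ?thesis
        unfolding U.lr_def unfolding cardAu normal_density_tilt[OF \<sigma>, of "h * _"] \<phi>_def
        by (simp add: sum_distrib_left)
    qed
    have A_split: "A = Au True \<union> Au False" "Au True \<inter> Au False = {}" by (auto simp: A_def Au_def)
    have split: "(\<Sum>c\<in>A. G c) = (\<Sum>c\<in>Au True. G c) + (\<Sum>c\<in>Au False. G c)" for G :: "bool list \<Rightarrow> real"
      unfolding A_split(1) using A_split(2) fin by (intro sum.union_disjoint) auto
    have part: "(\<Sum>c\<in>Au u. normal_density (h * s c) \<sigma> y * f c h y) =
        2 ^ m / 2 * (\<phi> y * U.lr u \<sigma> h y) * ((ln (U.lr u \<sigma> h y) - ln (T.lr \<sigma> h y)) / ln 2)" for u y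
    proof -
      have "(\<Sum>c\<in>Au u. normal_density (h * s c) \<sigma> y * f c h y) =
          (\<Sum>c\<in>Au u. normal_density (h * s c) \<sigma> y * ((ln (U.lr u \<sigma> h y) - ln (T.lr \<sigma> h y)) / ln 2))"
        by (intro sum.cong refl) (simp add: f_def Au_def)
      then show ?thesis by (simp only: sum_distrib_right[symmetric] sumU)
    qed
    \<comment> \<open>Both bit values are equally likely. This merges the two cross terms containing
      \<open>ln (T.lr \<sigma> h y)\<close> into the single entropy \<open>T.kl\<close>.\<close>
    have mix: "T.lr \<sigma> h y = (U.lr True \<sigma> h y + U.lr False \<sigma> h y) / 2" for y
    proof -
      have "2 ^ m * (\<phi> y * T.lr \<sigma> h y) = 2 ^ m * (\<phi> y * ((U.lr True \<sigma> h y + U.lr False \<sigma> h y) / 2))"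
        unfolding sumA[symmetric] split sumU by (simp add: algebra_simps add_divide_distrib)
      then show ?thesis using \<phi>[of y] by simp
    qed
    have "(\<Sum>c | length c = m. normal_density (h * s c) \<sigma> y * f c h y) / 2 ^ m =
        ((\<phi> y * (U.lr True \<sigma> h y * ln (U.lr True \<sigma> h y))
          + \<phi> y * (U.lr False \<sigma> h y * ln (U.lr False \<sigma> h y))) / 2
          - \<phi> y * (T.lr \<sigma> h y * ln (T.lr \<sigma> h y))) / ln 2" for y
    proof -
      have "(\<Sum>c | length c = m. normal_density (h * s c) \<sigma> y * f c h y) / 2 ^ m =
         (\<phi> y * U.lr True \<sigma> h y * (ln (U.lr True \<sigma> h y) - ln (T.lr \<sigma> h y))
         + \<phi> y * U.lr False \<sigma> h y * (ln (U.lr False \<sigma> h y) - ln (T.lr \<sigma> h y))) / 2 / ln 2"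
        unfolding A_def[symmetric] split part by (simp add: add_divide_distrib)
      also have "\<dots> = ((\<phi> y * (U.lr True \<sigma> h y * ln (U.lr True \<sigma> h y))
          + \<phi> y * (U.lr False \<sigma> h y * ln (U.lr False \<sigma> h y))) / 2
          - \<phi> y * ((U.lr True \<sigma> h y + U.lr False \<sigma> h y) / 2 * ln (T.lr \<sigma> h y))) / ln 2"
        by (simp add: algebra_simps add_divide_distrib diff_divide_distrib)
      finally show ?thesis by (simp only: mix[symmetric])
    qed
    then show ?thesis
      using U.integrable_kl[OF \<sigma>] T.integrable_kl[OF \<sigma>]
      by (simp add: J_def U.kl_def[OF \<sigma>] T.kl_def[OF \<sigma>] \<phi>_def)
  qed
  have J: "has_bochner_integral \<nu> J
      (\<integral>(c, h, z). f c h (h * s c + z) \<partial>channel m \<nu> N0)"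
    using has_bochner_integral_channel[where f = f and m = m and s = s, OF \<nu> N0 h2 meas bound] inner
    by (simp add: \<sigma>_def)
  \<comment> \<open>232 = 29 * 4 * 2: the 4 comes from squaring
    \<open>1 / \<sigma>\<^sup>2 = 2 / N0\<close>, the 2 from combining three entropies, two of them
    with weight 1/2.\<close>
  define E where "E = 232 * B ^ 4 / (N0\<^sup>2 * ln 2)"
  have J_approx: "\<bar>J h - h\<^sup>2 * (D / (N0 * ln 2))\<bar> \<le> E * h ^ 4" for h
  proof -
    have meanU: "U.mean u = average (Au u) s" for u
      by (simp add: U.mean_def average_def sum_divide_distrib)
    have meanT: "T.mean = average A s"
      by (simp add: T.mean_def average_def sum_divide_distrib)
    have D: "D = ((U.mean True)\<^sup>2 + (U.mean False)\<^sup>2) / 2 - T.mean\<^sup>2"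
      unfolding meanU meanT by (simp add: D_def Au_def A_def s_def)
    have combine: "\<bar>(a + b) / 2 - c - ((a' + b') / 2 - c')\<bar> \<le> 2 * R"
      if "\<bar>a - a'\<bar> \<le> R" "\<bar>b - b'\<bar> \<le> R" "\<bar>c - c'\<bar> \<le> R" for a b c a' b' c' R :: real
      using that by (simp add: abs_le_iff field_simps)
    define R where "R = 29 * (h\<^sup>2 / \<sigma>\<^sup>2 * B\<^sup>2)\<^sup>2"
    have "\<bar>U.kl True \<sigma> h - h\<^sup>2 / \<sigma>\<^sup>2 * (U.mean True)\<^sup>2 / 2\<bar> \<le> R"
      "\<bar>U.kl False \<sigma> h - h\<^sup>2 / \<sigma>\<^sup>2 * (U.mean False)\<^sup>2 / 2\<bar> \<le> R"
      "\<bar>T.kl \<sigma> h - h\<^sup>2 / \<sigma>\<^sup>2 * T.mean\<^sup>2 / 2\<bar> \<le> R"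
      unfolding R_def by (intro U.kl_approx[OF \<sigma>] T.kl_approx[OF \<sigma>])+
    then have "\<bar>(U.kl True \<sigma> h + U.kl False \<sigma> h) / 2 - T.kl \<sigma> h -
        ((h\<^sup>2 / \<sigma>\<^sup>2 * (U.mean True)\<^sup>2 / 2 + h\<^sup>2 / \<sigma>\<^sup>2 * (U.mean False)\<^sup>2 / 2) / 2
          - h\<^sup>2 / \<sigma>\<^sup>2 * T.mean\<^sup>2 / 2)\<bar> \<le> 2 * R"
      by (rule combine)
    also have "(h\<^sup>2 / \<sigma>\<^sup>2 * (U.mean True)\<^sup>2 / 2 + h\<^sup>2 / \<sigma>\<^sup>2 * (U.mean False)\<^sup>2 / 2) / 2
          - h\<^sup>2 / \<sigma>\<^sup>2 * T.mean\<^sup>2 / 2 = h\<^sup>2 * (D / N0)"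
      unfolding D \<sigma>2 using N0 by (simp add: field_simps)
    finally have "\<bar>(U.kl True \<sigma> h + U.kl False \<sigma> h) / 2 - T.kl \<sigma> h - h\<^sup>2 * (D / N0)\<bar> / ln 2 \<le> 2 * R / ln 2"
      by (rule divide_right_mono) simp
    moreover have "2 * R / ln 2 = E * h ^ 4"
      unfolding R_def \<sigma>2 E_def using N0 by (simp add: field_simps power2_eq_square power4_eq_xxxx)
    moreover have "J h - h\<^sup>2 * (D / (N0 * ln 2)) =
        ((U.kl True \<sigma> h + U.kl False \<sigma> h) / 2 - T.kl \<sigma> h - h\<^sup>2 * (D / N0)) / ln 2"
      by (simp add: J_def diff_divide_distrib)
    ultimately show ?thesis by (simp add: abs_divide)
  qed
  have "\<bar>(\<integral>h. J h - h\<^sup>2 * (D / (N0 * ln 2)) \<partial>\<nu>)\<bar> \<le> (\<integral>h. \<bar>J h - h\<^sup>2 * (D / (N0 * ln 2))\<bar> \<partial>\<nu>)"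
    by (rule integral_abs_bound)
  also have "\<dots> \<le> (\<integral>h. E * h ^ 4 \<partial>\<nu>)"
    using J h2 h4 J_approx by (intro integral_mono) (auto simp: has_bochner_integral_iff)
  also have "(\<integral>h. J h - h\<^sup>2 * (D / (N0 * ln 2)) \<partial>\<nu>) =
      (\<integral>(c, h, z). f c h (h * s c + z) \<partial>channel m \<nu> N0) - (\<integral>h. h\<^sup>2 \<partial>\<nu>) * (D / (N0 * ln 2))"
    using J h2 by (subst Bochner_Integration.integral_diff) (auto simp: has_bochner_integral_iff)
  finally show ?thesis
    by (simp add: E_def Let_def log_eq s_def)
qed

text \<open>Discrete layer-cake argument: with N the ceiling of \<open>h\<^sup>2\<close>,
  \<open>h ^ 4\<close> is at most N^2, the sum of \<open>2 * n + 1\<close> over n < N. Hence the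
  fourth moment is bounded by the sum of \<open>(2 * n + 1) * P n\<close>, and the tail decays
  faster than any power.\<close>

lemma integrable_fourth_power_of_tail:
  assumes \<nu>: "real_distribution \<nu>" and \<omega>: "0 < \<omega>"
    and tail: "\<forall>\<^sub>F \<Delta> in at_top. measure \<nu> {h. h\<^sup>2 > \<Delta>} \<le> exp (- (\<Delta> powr \<omega>))"
  shows "integrable \<nu> (\<lambda>h. h ^ 4)"
proof -
  interpret real_distribution \<nu> by (rule \<nu>)
  define P where "P n = measure \<nu> {h. h\<^sup>2 > real n}" for n
  have [measurable]: "{h. h\<^sup>2 > real n} \<in> sets \<nu>" for n
  proof -
    have "{h \<in> space borel. h\<^sup>2 > real n} \<in> sets borel" by measurable
    then show ?thesis by simp
  qed
  have pointwise: "ennreal (h ^ 4) \<le> (\<Sum>n. ennreal (2 * real n + 1) * indicator {h. h\<^sup>2 > real n} h)" for h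
  proof -
    define N where "N = nat \<lceil>h\<^sup>2\<rceil>"
    have below: "real n < h\<^sup>2" if "n < N" for n
      using that unfolding N_def by linarith
    have "h\<^sup>2 \<le> real N" unfolding N_def by (rule real_nat_ceiling_ge)
    then have "(h\<^sup>2)\<^sup>2 \<le> (real N)\<^sup>2" by (rule power_mono) simp
    then have "h ^ 4 \<le> (real N)\<^sup>2" by (simp flip: power_mult)
    also have "(real N)\<^sup>2 = (\<Sum>n<N. 2 * real n + 1)"
      by (induction N) (auto simp: power2_eq_square algebra_simps)
    finally have "ennreal (h ^ 4) \<le> ennreal (\<Sum>n<N. 2 * real n + 1)" by (rule ennreal_leI)
    also have "\<dots> = (\<Sum>n<N. ennreal (2 * real n + 1) * indicator {h. h\<^sup>2 > real n} h)"
      using below by (simp add: sum_ennreal[symmetric])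
    also have "\<dots> \<le> (\<Sum>n. ennreal (2 * real n + 1) * indicator {h. h\<^sup>2 > real n} h)"
      by (rule sum_le_suminf) auto
    finally show ?thesis .
  qed
  have "(\<integral>\<^sup>+h. ennreal (h ^ 4) \<partial>\<nu>) \<le>
      (\<integral>\<^sup>+h. (\<Sum>n. ennreal (2 * real n + 1) * indicator {h. h\<^sup>2 > real n} h) \<partial>\<nu>)"
    by (intro nn_integral_mono pointwise)
  also have "\<dots> = (\<Sum>n. \<integral>\<^sup>+h. ennreal (2 * real n + 1) * indicator {h. h\<^sup>2 > real n} h \<partial>\<nu>)"
    by (rule nn_integral_suminf) measurable
  also have "\<dots> = (\<Sum>n. ennreal ((2 * real n + 1) * P n))"
    by (intro suminf_cong) (simp add: nn_integral_cmult_indicator emeasure_eq_measure P_def ennreal_mult')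
  also have "\<dots> < \<infinity>"
  proof -
    have "\<forall>\<^sub>F n in sequentially. P n \<le> exp (- (real n powr \<omega>))"
      unfolding P_def using tail filterlim_real_sequentially by (rule eventually_compose_filterlim)
    moreover have "\<forall>\<^sub>F n in sequentially. (2 * real n + 1) * exp (- (real n powr \<omega>)) \<le> inverse (real n ^ 2)"
      using \<omega> by real_asymp
    ultimately have "\<forall>\<^sub>F n in sequentially. norm ((2 * real n + 1) * P n) \<le> inverse (real n ^ 2)"
    proof eventually_elim
      case (elim n)
      have "(2 * real n + 1) * P n \<le> (2 * real n + 1) * exp (- (real n powr \<omega>))"
        using elim by (intro mult_left_mono) auto
      also have "\<dots> \<le> inverse (real n ^ 2)" by (rule elim)
      finally show ?case by (simp add: P_def)
    qed
    moreover have "summable (\<lambda>n. inverse (real n ^ 2))" by (rule inverse_power_summable) simp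
    ultimately have "summable (\<lambda>n. (2 * real n + 1) * P n)"
      by (rule summable_comparison_test_ev)
    then have "(\<Sum>n. ennreal ((2 * real n + 1) * P n)) \<noteq> top"
      by (rule ennreal_suminf_neq_top) (auto simp: P_def)
    then show ?thesis unfolding infinity_ennreal_def by (rule top.not_eq_extremum[THEN iffD1])
  qed
  finally show ?thesis by (intro integrableI_bounded) auto
qed

text \<open>The single-bit estimates are summed. As \<open>snr\<close> is a fixed positive multiple
  of \<open>1 / N0\<close>, their errors of order \<open>1 / N0\<^sup>2\<close> are of order SNR
  squared, and the division by the energy turns \<open>1 / N0\<close> into SNR.\<close>

lemma is_bicm_coefficient_averages:
  assumes \<nu>: "real_distribution \<nu>" and h4: "integrable \<nu> (\<lambda>h. h ^ 4)"
    and pos: "0 < (\<integral>h. h\<^sup>2 \<partial>\<nu>)" "0 < symbol_energy m xs L"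
  shows "is_bicm_coefficient m xs L \<nu> (log 2 (exp 1) *
    (\<Sum>k<m. ((average {c. length c = m \<and> c ! k} (symbol xs L))\<^sup>2
      + (average {c. length c = m \<and> \<not> c ! k} (symbol xs L))\<^sup>2) / 2
      - (average {c. length c = m} (symbol xs L))\<^sup>2) / symbol_energy m xs L)"
    (is "is_bicm_coefficient _ _ _ _ (_ * sum ?D _ / _)")
proof -
  define B where "B = Max ((\<lambda>c. \<bar>symbol xs L c\<bar>) ` {c. length c = m})"
  have B: "\<bar>symbol xs L c\<bar> \<le> B" if "length c = m" for c
    unfolding B_def using that by (intro Max_ge) auto
  define E where "E = symbol_energy m xs L"
  define H where "H = (\<integral>h. h\<^sup>2 \<partial>\<nu>)"
  define C where "C = 232 * B ^ 4 * (\<integral>h. h ^ 4 \<partial>\<nu>) / ln 2"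
  have EH: "0 < E" "0 < H" using pos by (simp_all add: E_def H_def)
  have "norm (bicm_capacity m xs L \<nu> N0 - log 2 (exp 1) * sum ?D {..<m} / E * snr m xs L \<nu> N0)
      \<le> real m * C / (H * E)\<^sup>2 * norm ((snr m xs L \<nu> N0)\<^sup>2)" if N0: "0 < N0" for N0
  proof -
    have "log 2 (exp 1) * sum ?D {..<m} / E * snr m xs L \<nu> N0 = (\<Sum>k<m. H * ?D k / (N0 * ln 2))"
      using EH N0 by (simp add: snr_def E_def[symmetric] H_def[symmetric] log_def sum_distrib_left
          sum_divide_distrib mult_ac)
    then have "\<bar>bicm_capacity m xs L \<nu> N0 - log 2 (exp 1) * sum ?D {..<m} / E * snr m xs L \<nu> N0\<bar>
        \<le> (\<Sum>k<m. C / N0\<^sup>2)"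
      unfolding bicm_capacity_def
      using bicm_term_approx[OF \<nu> N0 h4 B]
      by (simp only: sum_subtractf[symmetric])
        (intro order_trans[OF sum_abs] sum_mono, simp add: H_def C_def mult.commute)
    also have "\<dots> = real m * C / (H * E)\<^sup>2 * norm ((snr m xs L \<nu> N0)\<^sup>2)"
      using EH N0 by (simp add: snr_def E_def[symmetric] H_def[symmetric] power_divide)
    finally show ?thesis by simp
  qed
  then show ?thesis
    unfolding is_bicm_coefficient_def E_def
    by (intro bigoI[where c = "real m * C / (H * E)\<^sup>2"] eventually_mono[OF eventually_gt_at_top[of 0]])
      (simp add: E_def)
qed

section \<open>Correlation of labelings with the PAM alphabet\<close>

lemma sum_symbol:
  assumes L: "is_labeling m L"
  shows "(\<Sum>c | length c = m. f c (symbol xs L c)) = (\<Sum>i<2 ^ m. f (L ! i) (xs ! i))"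
proof -
  note D = is_labelingD[OF L]
  have "bij_betw ((!) L) {..<2 ^ m} {c. length c = m}"
    using L D bij_betw_nth[of L "{..<2 ^ m}" "set L"] by (simp add: is_labeling_def)
  then have "(\<Sum>c | length c = m. f c (symbol xs L c)) = (\<Sum>i<2 ^ m. f (L ! i) (symbol xs L (L ! i)))"
    by (rule sum.reindex_bij_betw[symmetric])
  then show ?thesis using D by (simp add: symbol_nth)
qed

definition bit_sign :: "bool \<Rightarrow> real" where
  "bit_sign b = (if b then 1 else -1)"

text \<open>The weights are the entries of \<open>pam (length L)\<close>.\<close>

definition pam_correlation :: "(bool list \<Rightarrow> real) \<Rightarrow> bit_matrix \<Rightarrow> real" where
  "pam_correlation f L = (\<Sum>i<length L. f (L ! i) * (2 * real i + 1 - real (length L)))"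

lemma sum_pam_offset: "(\<Sum>i<n. 2 * real i + 1 - a) = (real n)\<^sup>2 - a * real n"
  by (induction n) (simp_all add: algebra_simps power2_eq_square)

lemma sum_pam_offset_square:
  "(\<Sum>i<n. (2 * real i + 1 - a)\<^sup>2) = real n * (4 * (real n)\<^sup>2 - 1) / 3 - 2 * a * (real n)\<^sup>2 + a\<^sup>2 * real n"
  by (induction n) (simp_all add: field_simps power2_eq_square)

lemma nth_pam: "i < M \<Longrightarrow> pam M ! i = 2 * real i + 1 - real M"
  by (simp add: pam_def)

lemma symbol_energy_pam:
  assumes L: "is_labeling m L"
  shows "symbol_energy m (pam (2 ^ m)) L = (4 ^ m - 1) / 3"
proof -
  have "symbol_energy m (pam (2 ^ m)) L = (\<Sum>c | length c = m. (symbol (pam (2 ^ m)) L c)\<^sup>2) / 2 ^ m"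
    unfolding symbol_energy_def bits_pmf_def using Ex_list_of_length[of m]
    by (subst integral_pmf_of_set) (auto simp: card_bit_vectors)
  also have "(\<Sum>c | length c = m. (symbol (pam (2 ^ m)) L c)\<^sup>2) = (\<Sum>i<2 ^ m. (2 * real i + 1 - 2 ^ m)\<^sup>2)"
    using sum_symbol[OF L, of "\<lambda>_ s. s\<^sup>2" "pam (2 ^ m)"] by (simp add: nth_pam)
  also have "\<dots> = 2 ^ m * ((2 ^ m)\<^sup>2 - 1) / 3"
    unfolding sum_pam_offset_square by (simp add: field_simps power2_eq_square)
  also have "(2 ^ m)\<^sup>2 = (4 :: real) ^ m" by (simp add: power2_eq_square flip: power_mult_distrib)
  finally show ?thesis by simp
qed

text \<open>The alphabet sums to zero, so the two conditional means are opposite and one signed sum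
  determines both.\<close>

lemma averages_pam:
  assumes L: "is_labeling m L" and k: "k < m"
  defines "S \<equiv> pam_correlation (\<lambda>c. bit_sign (c ! k)) L / 2 ^ m"
  shows "average {c. length c = m} (symbol (pam (2 ^ m)) L) = 0"
    and "average {c. length c = m \<and> c ! k} (symbol (pam (2 ^ m)) L) = S"
    and "average {c. length c = m \<and> \<not> c ! k} (symbol (pam (2 ^ m)) L) = - S"
proof -
  define s where "s = symbol (pam (2 ^ m)) L"
  have len: "length L = 2 ^ m" by (rule is_labelingD[OF L])
  have total: "(\<Sum>c | length c = m. s c) = 0"
    unfolding s_def using sum_symbol[OF L, of "\<lambda>_ s. s" "pam (2 ^ m)"] sum_pam_offset[of "2 ^ m" "2 ^ m"]
    by (simp add: nth_pam power2_eq_square)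
  then show "average {c. length c = m} (symbol (pam (2 ^ m)) L) = 0"
    by (simp add: average_def s_def)
  have signed: "(\<Sum>c | length c = m. bit_sign (c ! k) * s c) = 2 ^ m * S"
    unfolding s_def S_def pam_correlation_def len
    using sum_symbol[OF L, of "\<lambda>c s. bit_sign (c ! k) * s" "pam (2 ^ m)"] by (simp add: nth_pam)
  have half: "(\<Sum>c | length c = m \<and> c ! k = u. s c) = 2 ^ m / 2 * (bit_sign u * S)" for u
  proof -
    have "(\<Sum>c | length c = m \<and> c ! k = u. s c) = (\<Sum>c\<in>{c. length c = m} \<inter> {c. c ! k = u}. s c)"
      by (simp add: Int_def)
    \<comment> \<open>The indicator of \<open>c ! k = u\<close> is
      \<open>(1 + bit_sign u * bit_sign (c ! k)) / 2\<close>.\<close>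
    also have "\<dots> = (\<Sum>c | length c = m. (s c + bit_sign u * (bit_sign (c ! k) * s c)) / 2)"
      by (subst sum.inter_restrict) (auto simp: bit_sign_def intro!: sum.cong)
    also have "\<dots> = 2 ^ m / 2 * (bit_sign u * S)"
      by (simp add: sum_divide_distrib[symmetric] sum.distrib sum_distrib_left[symmetric] total signed)
    finally show ?thesis .
  qed
  have "average {c. length c = m \<and> c ! k = u} s = bit_sign u * S" for u
  proof -
    have "(2::real) ^ m / 2 = 2 ^ (m - 1)" using k by (simp add: power_diff)
    then show ?thesis
      unfolding average_def half card_bit_vectors_nth[OF k] by simp
  qed
  from this[of True] this[of False]
  show "average {c. length c = m \<and> c ! k} (symbol (pam (2 ^ m)) L) = S"
    "average {c. length c = m \<and> \<not> c ! k} (symbol (pam (2 ^ m)) L) = - S"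
    by (simp_all add: s_def bit_sign_def)
qed

text \<open>With means 0, S and -S, each bit contributes S^2, and the energy is
  \<open>(4 ^ m - 1) / 3\<close>. The first conjunct records that the definite description denotes
  an actual coefficient.\<close>

lemma bicm_coefficient_pam:
  assumes L: "is_labeling m L" and m: "1 \<le> m"
    and \<nu>: "real_distribution \<nu>" "integrable \<nu> (\<lambda>h. h ^ 4)" "0 < (\<integral>h. h\<^sup>2 \<partial>\<nu>)"
    and \<alpha>: "\<alpha> = 3 * (\<Sum>k<m. (pam_correlation (\<lambda>c. bit_sign (c ! k)) L / 2 ^ m)\<^sup>2) / (4 ^ m - 1) * log 2 (exp 1)"
  shows "is_bicm_coefficient m (pam (2 ^ m)) L \<nu> (bicm_coefficient m (pam (2 ^ m)) L \<nu>) \<and>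
    bicm_coefficient m (pam (2 ^ m)) L \<nu> = \<alpha>"
proof -
  have "(4::real) ^ 1 \<le> 4 ^ m" using m by (intro power_increasing) auto
  then have E: "0 < symbol_energy m (pam (2 ^ m)) L"
    by (simp add: symbol_energy_pam[OF L])
  have *: "is_bicm_coefficient m (pam (2 ^ m)) L \<nu> \<alpha>"
    using is_bicm_coefficient_averages[OF \<nu>(1,2,3) E] averages_pam[OF L]
    by (simp add: \<alpha> symbol_energy_pam[OF L] mult_ac)
  then have "bicm_coefficient m (pam (2 ^ m)) L \<nu> = \<alpha>"
    unfolding bicm_coefficient_def
    by (rule the_equality) (rule is_bicm_coefficient_unique[OF \<nu>(3) E _ *])
  with * show ?thesis by simp
qed

section \<open>Correlations of reflected labelings\<close>

lemma sum_lessThan_add: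
  fixes g :: "nat \<Rightarrow> 'a::comm_monoid_add"
  shows "(\<Sum>i<m + n. g i) = (\<Sum>i<m. g i) + (\<Sum>i<n. g (m + i))"
  by (induction n) (simp_all add: add.assoc)

lemma length_reflection [simp]: "length (reflection L) = 2 * length L"
  by (simp add: reflection_def)

text \<open>The second half of a reflection runs backwards, so each row is paired with its mirror
  image.\<close>

lemma sum_reflection:
  "(\<Sum>i<length (reflection L). g (reflection L ! i) i) =
    (\<Sum>i<length L. g (False # L ! i) i + g (True # L ! i) (2 * length L - 1 - i))"
proof -
  define n where "n = length L"
  define G where "G i = g (reflection L ! i) i" for i
  have "(\<Sum>i<2 * n. G i) = (\<Sum>i<n. G i) + (\<Sum>i<n. G (n + i))"
    by (simp add: mult_2 sum_lessThan_add)
  also have "(\<Sum>i<n. G (n + i)) = (\<Sum>i<n. G (n + (n - Suc i)))"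
    by (rule sum.nat_diff_reindex[symmetric])
  also have "(\<Sum>i<n. G i) = (\<Sum>i<n. g (False # L ! i) i)"
    by (intro sum.cong) (auto simp: G_def reflection_def nth_append n_def)
  also have "(\<Sum>i<n. G (n + (n - Suc i))) = (\<Sum>i<n. g (True # L ! i) (2 * n - 1 - i))"
    by (intro sum.cong) (auto simp: G_def reflection_def nth_append n_def rev_nth mult_2
        intro!: arg_cong2[of _ _ _ _ g])
  finally show ?thesis by (simp add: G_def n_def sum.distrib)
qed

text \<open>Mirrored indices carry opposite weights. Whatever does not depend on the new leading bit
  therefore cancels.\<close>

lemma pam_correlation_reflection:
  "pam_correlation f (reflection L) =
    (\<Sum>i<length L. (f (False # L ! i) - f (True # L ! i)) * (2 * real i + 1 - 2 * real (length L)))"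
  unfolding pam_correlation_def sum_reflection[where g = "\<lambda>c i. f c * (2 * real i + 1 - real (length (reflection L)))"]
  by (intro sum.cong) (auto simp: of_nat_diff algebra_simps)

lemma pam_correlation_reflection_0:
  "pam_correlation (\<lambda>c. bit_sign (c ! 0)) (reflection L) = 2 * (real (length L))\<^sup>2"
proof -
  have "pam_correlation (\<lambda>c. bit_sign (c ! 0)) (reflection L) =
      (\<Sum>i<length L. (-2) * (2 * real i + 1 - 2 * real (length L)))"
    by (simp only: pam_correlation_reflection bit_sign_def nth_Cons_0) simp
  then show ?thesis
    unfolding sum_distrib_left[symmetric] sum_pam_offset by (simp add: power2_eq_square)
qed

lemma pam_correlation_reflection_Suc:
  "pam_correlation (\<lambda>c. bit_sign (c ! Suc k)) (reflection L) = 0"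
  by (simp add: pam_correlation_reflection)

text \<open>Only the leading column contributes, whatever \<open>L\<close> is; this is why the BRGC
  and the FBC have the same coefficient.\<close>

lemma sum_correlation_reflection:
  assumes "length L = 2 ^ n"
  shows "(\<Sum>k<Suc n. (pam_correlation (\<lambda>c. bit_sign (c ! k)) (reflection L) / 2 ^ Suc n)\<^sup>2) = 4 ^ n"
proof -
  have "(2 * (2 ^ n)\<^sup>2 / 2 ^ Suc n :: real) = 2 ^ n" by (simp add: power2_eq_square)
  then have "(\<Sum>k<Suc n. (pam_correlation (\<lambda>c. bit_sign (c ! k)) (reflection L) / 2 ^ Suc n)\<^sup>2) = ((2::real) ^ n)\<^sup>2"
    unfolding sum.lessThan_Suc_shift
    by (simp only: pam_correlation_reflection_0 pam_correlation_reflection_Suc assms of_nat_power of_nat_numeral) simp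
  then show ?thesis by (simp add: power2_eq_square flip: power_mult_distrib)
qed

text \<open>Starting from the labeling of order 0, whose only row is empty, makes even the first
  column a reflection, so the reflection lemmas apply throughout.\<close>

lemma brgc_eq_reflections: "1 \<le> m \<Longrightarrow> brgc m = (reflection ^^ m) [[]]"
proof -
  assume "1 \<le> m"
  then obtain n where n: "m = Suc n" by (cases m) auto
  have "reflection [[]] = [[False], [True]]" by (simp add: reflection_def)
  then show ?thesis by (simp add: brgc_def n funpow_Suc_right del: funpow.simps)
qed

lemma length_reflections [simp]: "length ((reflection ^^ n) [[]]) = 2 ^ n"
  by (induction n) auto

lemma length_row_reflections: "c \<in> set ((reflection ^^ n) [[]]) \<Longrightarrow> length c = n"
  by (induction n arbitrary: c) (auto simp: reflection_def)

text \<open>A reflection repeats the last bit of every nonempty row, so it only doubles the sum,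
  which is zero for the rows 0 and 1.\<close>

lemma last_column_reflections:
  assumes "1 \<le> n"
  shows "(\<Sum>i<2 ^ n. bit_sign (last ((reflection ^^ n) [[]] ! i))) = 0"
  using assms
proof (induction n rule: dec_induct)
  case base
  then show ?case by (simp add: reflection_def bit_sign_def numeral_2_eq_2)
next
  case (step n)
  let ?L = "(reflection ^^ n) [[]]"
  have "?L ! i \<noteq> []" if "i < 2 ^ n" for i
    using length_row_reflections[of "?L ! i" n] nth_mem[of i ?L] that step.hyps by auto
  then show ?case
    using sum_reflection[of "\<lambda>c i. bit_sign (last c)" ?L] step.IH
    by (simp add: sum_distrib_left[symmetric])
qed

text \<open>All columns but the first are those of the BRGC and cancel. The first one equals the
  last column on the first half and its complement on the second, which leads to the last column of
  the BRGC of order \<open>m - 1\<close>.\<close>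

lemma pam_correlation_bsgc:
  assumes m: "3 \<le> m" and k: "k < m"
  shows "pam_correlation (\<lambda>c. bit_sign (c ! k)) (bsgc m) = 0"
proof -
  define n where "n = m - 2"
  have n: "m = Suc (Suc n)" "1 \<le> n" using m by (simp_all add: n_def)
  let ?L = "\<lambda>n. (reflection ^^ n) [[]]"
  have row: "?L n ! i \<noteq> []" if "i < 2 ^ n" "1 \<le> n" for i n
    using length_row_reflections[of "?L n ! i" n] nth_mem[of i "?L n"] that by auto
  have bsgc: "pam_correlation f (bsgc m) = pam_correlation (\<lambda>c. f ((hd c \<noteq> last c) # tl c)) (reflection (?L (Suc n)))" for f
    using brgc_eq_reflections[of m] n by (simp add: pam_correlation_def bsgc_def)
  show ?thesis
  proof (cases k)
    case 0
    \<comment> \<open>As \<open>n \<ge> 1\<close>, the last column here is not the leading one, so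
      the outermost reflection makes it orthogonal to the alphabet.\<close>
    have corr: "pam_correlation (\<lambda>c. bit_sign (last c)) (?L (Suc n)) = 0"
      unfolding funpow.simps o_apply pam_correlation_reflection using row n by (intro sum.neutral) auto
    have "pam_correlation (\<lambda>c. bit_sign (c ! k)) (bsgc m) =
        2 * (\<Sum>i<2 ^ Suc n. bit_sign (last (?L (Suc n) ! i)) * (2 * real i + 1 - 2 * 2 ^ Suc n))"
      unfolding bsgc pam_correlation_reflection sum_distrib_left length_reflections
      by (intro sum.cong) (auto simp: 0 bit_sign_def row simp del: funpow.simps)
    \<comment> \<open>The weights are centred for order \<open>m\<close>. Recentring them for order
      \<open>m - 1\<close> leaves a multiple of the plain column sum, which vanishes too.\<close>
    also have "(\<Sum>i<2 ^ Suc n. bit_sign (last (?L (Suc n) ! i)) * (2 * real i + 1 - 2 * 2 ^ Suc n)) =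
        pam_correlation (\<lambda>c. bit_sign (last c)) (?L (Suc n)) -
        2 ^ Suc n * (\<Sum>i<2 ^ Suc n. bit_sign (last (?L (Suc n) ! i)))"
      unfolding pam_correlation_def length_reflections sum_distrib_left sum_subtractf[symmetric]
      by (intro sum.cong) (auto simp: algebra_simps simp del: funpow.simps)
    also have "\<dots> = 0" unfolding corr by (subst last_column_reflections) auto
    finally show ?thesis by simp
  next
    case (Suc j)
    have "j < Suc n" using Suc k n by simp
    then show ?thesis unfolding bsgc pam_correlation_reflection by (simp add: Suc)
  qed
qed

section \<open>Correlations of the natural binary code\<close>

lemma correlation_bit:
  "q < m \<Longrightarrow> (\<Sum>i<2 ^ m. bit_sign (bit i q) * (2 * real i + 1 - 2 ^ m)) = 2 ^ m * 2 ^ q"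
proof (induction m)
  case (Suc m)
  have double: "{..<2 ^ Suc m} = {..<2 ^ m + 2 ^ m :: nat}" by simp
  \<comment> \<open>The indices are split by their top bit. If \<open>q = m\<close>, the bit is
    constant on each half and paired weights differ by \<open>2 ^ Suc m\<close>; otherwise the bit
    repeats and paired weights add up to twice the weight of order \<open>m\<close>.\<close>
  have "(\<Sum>i<2 ^ Suc m. bit_sign (bit i q) * (2 * real i + 1 - 2 ^ Suc m)) =
      (\<Sum>i<2 ^ m. bit_sign (bit i q) * (2 * real i + 1 - 2 ^ Suc m)) +
      (\<Sum>i<2 ^ m. bit_sign (bit (2 ^ m + i) q) * (2 * real i + 1))"
    unfolding double sum_lessThan_add by simp
  also have "\<dots> = 2 ^ Suc m * 2 ^ q"
  proof (cases "q = m")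
    case True
    have "bit (2 ^ m + i) m" "\<not> bit i m" if "i < 2 ^ m" for i :: nat
      using that by (simp_all add: bit_iff_odd div_add1_eq)
    then show ?thesis
      by (simp add: True bit_sign_def sum_negf[symmetric] sum.distrib[symmetric])
  next
    case False
    then have q: "q < m" using Suc.prems by simp
    have "bit (2 ^ m + i) q = bit i q" for i :: nat
    proof -
      have "(2 ^ m + i) div 2 ^ q = 2 * 2 ^ (m - q - 1) + i div 2 ^ q"
      proof -
        have "(2::nat) ^ m = (2 * 2 ^ (m - q - 1)) * 2 ^ q"
          using q by (simp flip: power_Suc power_add)
        then show ?thesis by (simp add: div_mult_self4)
      qed
      then show ?thesis by (simp add: bit_iff_odd)
    qed
    then have "(\<Sum>i<2 ^ m. bit_sign (bit i q) * (2 * real i + 1 - 2 ^ Suc m)) +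
        (\<Sum>i<2 ^ m. bit_sign (bit (2 ^ m + i) q) * (2 * real i + 1)) =
        2 * (\<Sum>i<2 ^ m. bit_sign (bit i q) * (2 * real i + 1 - 2 ^ m))"
      by (simp add: sum.distrib[symmetric] sum_distrib_left algebra_simps)
    then show ?thesis using Suc.IH[OF q] by simp
  qed
  finally show ?case .
qed simp

text \<open>The normalized correlations are powers of 2, so their squares form a geometric series.
  Its sum equals the symbol energy, which is why the coefficient becomes exactly
  \<open>log 2 (exp 1)\<close>.\<close>

lemma sum_correlation_nbc:
  "(\<Sum>k<m. (pam_correlation (\<lambda>c. bit_sign (c ! k)) (nbc m) / 2 ^ m)\<^sup>2) = (4 ^ m - 1) / 3"
proof -
  have "pam_correlation (\<lambda>c. bit_sign (c ! k)) (nbc m) = 2 ^ m * 2 ^ (m - Suc k)" if "k < m" for k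
    using that correlation_bit[of "m - Suc k" m] by (simp add: pam_correlation_def nbc_def)
  then have "(\<Sum>k<m. (pam_correlation (\<lambda>c. bit_sign (c ! k)) (nbc m) / 2 ^ m)\<^sup>2) = (\<Sum>k<m. 4 ^ (m - Suc k))"
    by (intro sum.cong) (simp_all add: power2_eq_square flip: power_mult_distrib)
  also have "\<dots> = (\<Sum>k<m. 4 ^ k)" by (rule sum.nat_diff_reindex)
  also have "\<dots> = (4 ^ m - 1) / 3" by (simp add: geometric_sum)
  finally show ?thesis .
qed

theorem theorem20:
  fixes m M :: nat and L :: bit_matrix and \<nu> :: "real measure"
  assumes "M = 2 ^ m"
    and "real_distribution \<nu>"
    and "integrable \<nu> (\<lambda>h. h\<^sup>2)" and "0 < (\<integral>h. h\<^sup>2 \<partial>\<nu>)"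
    and "\<exists>\<omega>>0. \<forall>\<^sub>F \<Delta> in at_top. measure \<nu> {h. h\<^sup>2 > \<Delta>} \<le> exp (- (\<Delta> powr \<omega>))"
  shows "((L = brgc m \<and> 1 \<le> m) \<or> (L = fbc m \<and> 2 \<le> m) \<longrightarrow>
           is_bicm_coefficient m (pam M) L \<nu> (bicm_coefficient m (pam M) L \<nu>) \<and>
           bicm_coefficient m (pam M) L \<nu> =
             3 * (real M)\<^sup>2 / (4 * ((real M)\<^sup>2 - 1)) * log 2 (exp 1)) \<and>
         (L = nbc m \<and> 1 \<le> m \<longrightarrow>
           is_bicm_coefficient m (pam M) L \<nu> (bicm_coefficient m (pam M) L \<nu>) \<and>
           bicm_coefficient m (pam M) L \<nu> = log 2 (exp 1)) \<and>
         (L = bsgc m \<and> 3 \<le> m \<longrightarrow>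
           is_bicm_coefficient m (pam M) L \<nu> (bicm_coefficient m (pam M) L \<nu>) \<and>
           bicm_coefficient m (pam M) L \<nu> = 0)"
proof -
  have "integrable \<nu> (\<lambda>h. h ^ 4)"
    using assms integrable_fourth_power_of_tail by blast
  note coefficient = bicm_coefficient_pam[OF _ _ assms(2) this assms(4)]
  have M2: "(real M)\<^sup>2 = 4 ^ m"
    by (simp add: assms(1) power2_eq_square flip: power_mult_distrib)
  \<comment> \<open>The BRGC and the FBC are treated together: it only matters that \<open>L\<close>
    is a labeling and a reflection.\<close>
  have reflected: "is_bicm_coefficient m (pam M) L \<nu> (bicm_coefficient m (pam M) L \<nu>) \<and>
      bicm_coefficient m (pam M) L \<nu> = 3 * (real M)\<^sup>2 / (4 * ((real M)\<^sup>2 - 1)) * log 2 (exp 1)"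
    if L: "L = reflection K" "length K = 2 ^ (m - 1)" "is_labeling m L" and m: "1 \<le> m" for K
  proof -
    obtain n where n: "m = Suc n" using m by (cases m) auto
    have total: "(\<Sum>k<m. (pam_correlation (\<lambda>c. bit_sign (c ! k)) L / 2 ^ m)\<^sup>2) = 4 ^ m / 4"
      using sum_correlation_reflection[of K n] L n by simp
    show ?thesis
      unfolding M2 unfolding assms(1) by (rule coefficient[OF L(3) m], subst total, simp)
  qed
  show ?thesis
  proof (intro conjI[of "_ \<longrightarrow> _"] impI)
    assume "(L = brgc m \<and> 1 \<le> m) \<or> (L = fbc m \<and> 2 \<le> m)"
    then show "is_bicm_coefficient m (pam M) L \<nu> (bicm_coefficient m (pam M) L \<nu>) \<and>
      bicm_coefficient m (pam M) L \<nu> = 3 * (real M)\<^sup>2 / (4 * ((real M)\<^sup>2 - 1)) * log 2 (exp 1)"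
    proof
      assume L: "L = brgc m \<and> 1 \<le> m"
      have "is_labeling m L" using L is_labeling_brgc by simp
      moreover have "L = reflection ((reflection ^^ (m - 1)) [[]])"
        using L brgc_eq_reflections[of m] by (cases m) auto
      ultimately show ?thesis using L by (intro reflected[of "(reflection ^^ (m - 1)) [[]]"]) auto
    next
      assume L: "L = fbc m \<and> 2 \<le> m"
      then show ?thesis
        using is_labeling_fbc[of m] is_labelingD(2)[OF is_labeling_nbc[of "m - 1"]]
        by (intro reflected[of "nbc (m - 1)"]) (auto simp: fbc_def)
    qed
  next
    assume L: "L = nbc m \<and> 1 \<le> m"
    \<comment> \<open>This keeps the denominator \<open>4 ^ m - 1\<close> nonzero, so that it
      cancels against the geometric sum.\<close>
    then have "(4::real) ^ 1 \<le> 4 ^ m" by (intro power_increasing) auto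
    then show "is_bicm_coefficient m (pam M) L \<nu> (bicm_coefficient m (pam M) L \<nu>) \<and>
      bicm_coefficient m (pam M) L \<nu> = log 2 (exp 1)"
      unfolding assms(1) using L is_labeling_nbc
      by (intro coefficient) (simp_all add: sum_correlation_nbc)
  next
    assume L: "L = bsgc m \<and> 3 \<le> m"
    then show "is_bicm_coefficient m (pam M) L \<nu> (bicm_coefficient m (pam M) L \<nu>) \<and>
      bicm_coefficient m (pam M) L \<nu> = 0"
      unfolding assms(1) using L is_labeling_bsgc
      by (intro coefficient) (simp_all add: pam_correlation_bsgc)
  qed
qed

end
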